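(* Let $(V,\omega)$ be a symplectic vector space of dimension $2n$, let $0\le k\le n$, and let $W\subset V$ be a $k$-dimensional isotropic subspace. The assignment $H\mapsto S^H$ (described in the context) induces a natural one-to-one correspondence between Abelian simply transitive affine groups $H$ of symplectic type on $V$ whose (maximal) translation subgroup has dimension $2n-k$, up to conjugation in $\mathrm{Aff}_{\mathrm{Sp}(V)}(V)$, and homogeneous cubic polynomials in $S^3W_{reg}$ up to the linear action of $\mathrm{GL}(W)$.
   Context: $V$ is a finite-dimensional real vector space with nondegenerate alternating form $\omega$. $\mathrm{Aff}_{\mathrm{Sp}(V)}(V)$ is the group of affine transformations of $V$ with linear part in $\mathrm{Sp}(V)$. An affine group of symplectic type is a connected Lie subgroup $H$ of it; it is simply transitive if the orbit map $\varphi:H\to V$, $h\mapsto h0$, is a diffeomorphism. The translation subgroup of $H$ is the subgroup of all translations contained in $H$. Association $H\mapsto S^H$: for $H$ Abelian and simply transitive with Lie algebra $\mathfrak h\subset\mathfrak{sp}(V)\ltimes V$ and $\phi=d\varphi:\mathfrak h\to V$ (an isomorphism), one has $\phi^{-1}(X)=(S_X,X)$ with linear part $S_X\in\mathfrak{sp}(V)$, and $S_XY=S_YX$. So $S=S^H$ lies in $\mathfrak{sp}(V)^{(1)}=(V^*\otimes\mathfrak{sp}(V))\cap(S^2V^*\otimes V)$. This space is identified with $S^3V^*$ via the trilinear form $\omega(S_XY,Z)$, and with $S^3V$ via $V\cong V^*$, $v\mapsto\omega(v,\cdot)$. The correspondence is: the conjugacy class of $H$ corresponds to the $\mathrm{GL}(W)$-orbit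 formed by the elements of $S^3W_{reg}$ lying in the $\mathrm{Sp}(V)$-orbit of $S^H$ in $S^3V$. For $S\in S^3V\cong\mathfrak{sp}(V)^{(1)}$, the support is $\Sigma_S=\mathrm{span}\{S_XY\mid X,Y\in V\}$. For a subspace $W\subset V$, $S^3W_{reg}=\{S\in S^3W\mid\Sigma_S=W\}$. *)

theory Defs
  imports "HOL-Analysis.Analysis" "HOL-Algebra.Group"
begin

section \<open>Smooth manifolds and Lie subgroups\<close>

text \<open>
  \<open>C_k k U f\<close>: the function \<open>f\<close> is of class \<open>C\<^sup>k\<close> on the open set \<open>U\<close>, expressed through iterated
  directional derivatives.  All domains used below are finite-dimensional, so this is the usual notion.
\<close>

primrec C_k :: "nat \<Rightarrow> 'e::real_normed_vector set \<Rightarrow> ('e \<Rightarrow> 'f::real_normed_vector) \<Rightarrow> bool" where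
  "C_k 0 U f \<longleftrightarrow> continuous_on U f"
| "C_k (Suc k) U f \<longleftrightarrow> (\<forall>x\<in>U. f differentiable (at x)) \<and>
      (\<forall>v. C_k k U (\<lambda>x. frechet_derivative f (at x) v))"

text \<open>
  Smoothness on an arbitrary subset: local extendability to a smooth function on an open set.  For a
  relatively open subset of a linear subspace this is ordinary smoothness on that subspace.
\<close>

definition smooth_on :: "'e::real_normed_vector set \<Rightarrow> ('e \<Rightarrow> 'f::real_normed_vector) \<Rightarrow> bool" where
  "smooth_on S f \<longleftrightarrow> (\<forall>x\<in>S. \<exists>U g. open U \<and> x \<in> U \<and> (\<forall>k. C_k k U g) \<and> (\<forall>y\<in>U \<inter> S. g y = f y))"

text \<open>
  The charts of a \<open>d\<close>-dimensional manifold take values in a \<open>d\<close>-dimensional linear subspace (the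
  model) of a fixed normed space, so that \<open>d\<close> may vary while the types stay fixed.
\<close>

record ('m, 'e) manifold =
  mtop :: "'m topology"
  model :: "'e set"
  atlas :: "('m set \<times> ('m \<Rightarrow> 'e)) set"

definition smooth_manifold :: "('m, 'e::real_normed_vector) manifold \<Rightarrow> bool" where
  "smooth_manifold M \<longleftrightarrow>
     Hausdorff_space (mtop M) \<and> second_countable (mtop M) \<and>
     (\<exists>B. finite B \<and> model M = span B) \<and>
     (\<Union>(fst ` atlas M) = topspace (mtop M)) \<and>
     (\<forall>(N, c) \<in> atlas M. openin (mtop M) N \<and> openin (top_of_set (model M)) (c ` N) \<and>
        homeomorphic_map (subtopology (mtop M) N) (top_of_set (c ` N)) c) \<and>
     (\<forall>(N, c) \<in> atlas M. \<forall>(N', c') \<in> atlas M. smooth_on (c ` (N \<inter> N')) (c' \<circ> inv_into N c))"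

definition vector_manifold :: "('e::real_normed_vector, 'e) manifold" where
  "vector_manifold = \<lparr>mtop = euclidean, model = UNIV, atlas = {(UNIV, id)}\<rparr>"

definition prod_manifold ::
  "('m, 'e) manifold \<Rightarrow> ('n, 'f) manifold \<Rightarrow> ('m \<times> 'n, 'e \<times> 'f) manifold" where
  "prod_manifold M M' =
     \<lparr>mtop = prod_topology (mtop M) (mtop M'), model = model M \<times> model M',
      atlas = {(N \<times> N', map_prod c c') | N c N' c'. (N, c) \<in> atlas M \<and> (N', c') \<in> atlas M'}\<rparr>"

definition smooth_map ::
  "('m, 'e::real_normed_vector) manifold \<Rightarrow> ('n, 'f::real_normed_vector) manifold \<Rightarrow> ('m \<Rightarrow> 'n) \<Rightarrow> bool"
where
  "smooth_map M M' f \<longleftrightarrow> continuous_map (mtop M) (mtop M') f \<and>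
     (\<forall>(N, c) \<in> atlas M. \<forall>(N', c') \<in> atlas M'.
        smooth_on (c ` (N \<inter> f -` N')) (c' \<circ> f \<circ> inv_into N c))"

definition diffeomorphism ::
  "('m, 'e::real_normed_vector) manifold \<Rightarrow> ('n, 'f::real_normed_vector) manifold \<Rightarrow> ('m \<Rightarrow> 'n) \<Rightarrow> bool"
where
  "diffeomorphism M M' f \<longleftrightarrow> bij_betw f (topspace (mtop M)) (topspace (mtop M')) \<and>
     smooth_map M M' f \<and> smooth_map M' M (inv_into (topspace (mtop M)) f)"

text \<open>
  Immersions into a normed space.  The derivative at \<open>p\<close> within the relatively open set \<open>c ` N\<close> is
  determined precisely on the model space, which is where injectivity is required.
\<close>

definition immersion :: "('m, 'e::real_normed_vector) manifold \<Rightarrow> ('m \<Rightarrow> 'f::real_normed_vector) \<Rightarrow> bool"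
where
  "immersion M f \<longleftrightarrow> smooth_map M vector_manifold f \<and>
     (\<forall>(N, c) \<in> atlas M. \<forall>p \<in> c ` N. \<exists>D.
        (f \<circ> inv_into N c has_derivative D) (at p within c ` N) \<and> inj_on D (model M))"


section \<open>Affine transformations of symplectic type\<close>

definition symplectic_form :: "('a::real_vector \<Rightarrow> 'a \<Rightarrow> real) \<Rightarrow> bool" where
  "symplectic_form \<omega> \<longleftrightarrow> bilinear \<omega> \<and> (\<forall>x. \<omega> x x = 0) \<and> (\<forall>x. (\<forall>y. \<omega> x y = 0) \<longrightarrow> x = 0)"

definition isotropic :: "('a \<Rightarrow> 'a \<Rightarrow> real) \<Rightarrow> 'a set \<Rightarrow> bool" where
  "isotropic \<omega> W \<longleftrightarrow> (\<forall>x\<in>W. \<forall>y\<in>W. \<omega> x y = 0)"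

definition Sp :: "('a::real_normed_vector \<Rightarrow> 'a \<Rightarrow> real) \<Rightarrow> ('a \<Rightarrow>\<^sub>L 'a) set" where
  "Sp \<omega> = {A :: 'a \<Rightarrow>\<^sub>L 'a. \<forall>x y. \<omega> (A x) (A y) = \<omega> x y}"

text \<open>The pair \<open>(A, v)\<close> stands for the affine transformation \<open>x \<mapsto> A x + v\<close>.\<close>

type_synonym 'a affine_map = "('a \<Rightarrow>\<^sub>L 'a) \<times> 'a"

fun aff_apply :: "'a::real_normed_vector affine_map \<Rightarrow> 'a \<Rightarrow> 'a" where
  "aff_apply (A, v) x = A x + v"

definition AffSp :: "('a::real_normed_vector \<Rightarrow> 'a \<Rightarrow> real) \<Rightarrow> 'a affine_map monoid" where
  "AffSp \<omega> = \<lparr>carrier = Sp \<omega> \<times> UNIV,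
     mult = (\<lambda>(A, v) (B, w). (A o\<^sub>L B, A w + v)),
     one = (id_blinfun, 0)\<rparr>"

text \<open>
  \<open>M\<close> is a structure of (not necessarily connected) Lie subgroup on \<open>H\<close>, i.e. a Lie group structure
  for which the inclusion is an immersion.  As the ambient group is a closed embedded
  submanifold of the vector space of pairs, the inclusion may be tested in that vector space.
\<close>

definition Lie_subgroup ::
  "('a::real_normed_vector \<Rightarrow> 'a \<Rightarrow> real) \<Rightarrow> ('a affine_map, 'a affine_map) manifold \<Rightarrow> 'a affine_map set \<Rightarrow> bool"
where
  "Lie_subgroup \<omega> M H \<longleftrightarrow> subgroup H (AffSp \<omega>) \<and> smooth_manifold M \<and> topspace (mtop M) = H \<and>
     smooth_map (prod_manifold M M) M (\<lambda>(g, h). g \<otimes>\<^bsub>AffSp \<omega>\<^esub> h) \<and>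
     smooth_map M M (\<lambda>g. inv\<^bsub>AffSp \<omega>\<^esub> g) \<and>
     immersion M (\<lambda>h. h)"

text \<open>
  The tangent space at the identity, as velocities of smooth curves.  The Lie group structure on the
  set \<open>H\<close> is unique, so the quantification over \<open>M\<close> involves no choice.
\<close>

definition Lie_algebra ::
  "('a::real_normed_vector \<Rightarrow> 'a \<Rightarrow> real) \<Rightarrow> 'a affine_map set \<Rightarrow> 'a affine_map set" where
  "Lie_algebra \<omega> H = {\<xi>. \<exists>M \<gamma>. Lie_subgroup \<omega> M H \<and> smooth_map (vector_manifold :: (real, real) manifold) M \<gamma> \<and>
     \<gamma> 0 = \<one>\<^bsub>AffSp \<omega>\<^esub> \<and> (\<gamma> has_vector_derivative \<xi>) (at 0)}"

text \<open>Connected Lie subgroups whose orbit map \<open>h \<mapsto> h 0\<close> is a diffeomorphism onto \<open>V\<close>.\<close>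

definition simply_transitive_symplectic_type ::
  "('a::real_normed_vector \<Rightarrow> 'a \<Rightarrow> real) \<Rightarrow> 'a affine_map set \<Rightarrow> bool" where
  "simply_transitive_symplectic_type \<omega> H \<longleftrightarrow>
     (\<exists>M. Lie_subgroup \<omega> M H \<and> connected_space (mtop M) \<and>
          diffeomorphism M vector_manifold (\<lambda>h. aff_apply h 0))"

definition translation_subgroup :: "'a::real_normed_vector affine_map set \<Rightarrow> 'a affine_map set" where
  "translation_subgroup H = {(A, v) \<in> H. A = id_blinfun}"

text \<open>The dimension of a Lie group is that of its Lie algebra.\<close>

definition Abelian_groups ::
  "('a::real_normed_vector \<Rightarrow> 'a \<Rightarrow> real) \<Rightarrow> nat \<Rightarrow> 'a affine_map set set" where
  "Abelian_groups \<omega> d = {H. simply_transitive_symplectic_type \<omega> H \<and>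
     comm_group ((AffSp \<omega>)\<lparr>carrier := H\<rparr>) \<and>
     dim (Lie_algebra \<omega> (translation_subgroup H)) = d}"

definition conj_rel ::
  "('a::real_normed_vector \<Rightarrow> 'a \<Rightarrow> real) \<Rightarrow> nat \<Rightarrow> ('a affine_map set \<times> 'a affine_map set) set" where
  "conj_rel \<omega> d = {(H, H'). H \<in> Abelian_groups \<omega> d \<and> H' \<in> Abelian_groups \<omega> d \<and>
     (\<exists>g \<in> carrier (AffSp \<omega>). H' = (\<lambda>h. g \<otimes>\<^bsub>AffSp \<omega>\<^esub> h \<otimes>\<^bsub>AffSp \<omega>\<^esub> inv\<^bsub>AffSp \<omega>\<^esub> g) ` H)}"


section \<open>Cubic tensors\<close>

text \<open>
  The map \<open>X \<mapsto> S\<^sub>X\<close>, where \<open>(S\<^sub>X, X)\<close> is the preimage of \<open>X\<close> under the differential of the orbit map.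
  The orbit map \<open>(A, v) \<mapsto> v\<close> is the restriction of the linear map \<open>snd\<close>, hence so is its differential.
\<close>

definition S_of ::
  "('a::real_normed_vector \<Rightarrow> 'a \<Rightarrow> real) \<Rightarrow> 'a affine_map set \<Rightarrow> 'a \<Rightarrow> 'a \<Rightarrow> 'a" where
  "S_of \<omega> H X Y = blinfun_apply (fst (inv_into (Lie_algebra \<omega> H) snd X)) Y"

definition support :: "('a::real_vector \<Rightarrow> 'a \<Rightarrow> 'a) \<Rightarrow> 'a set" where
  "support S = span {S X Y | X Y. True}"

type_synonym 'a cubic = "('a \<Rightarrow>\<^sub>L real) \<Rightarrow> ('a \<Rightarrow>\<^sub>L real) \<Rightarrow> ('a \<Rightarrow>\<^sub>L real) \<Rightarrow> real"

text \<open>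
  \<open>S\<^sup>3W\<close> as the symmetric trilinear forms on \<open>W\<^sup>*\<close>, embedded into \<open>S\<^sup>3V\<close> by means of the restriction
  \<open>V\<^sup>* \<rightarrow> W\<^sup>*\<close>: the forms on \<open>V\<^sup>*\<close> which depend only on the restrictions of their arguments to \<open>W\<close>.
  The cubic polynomial corresponding to \<open>T\<close> is \<open>\<alpha> \<mapsto> T \<alpha> \<alpha> \<alpha>\<close>.  \<open>S\<^sup>3V\<close> is the case \<open>W = UNIV\<close>.
\<close>

definition S3 :: "'a::real_normed_vector set \<Rightarrow> 'a cubic set" where
  "S3 W = {T :: 'a cubic. (\<forall>\<beta> \<gamma>. linear (\<lambda>\<alpha>. T \<alpha> \<beta> \<gamma>)) \<and> (\<forall>\<alpha> \<gamma>. linear (\<lambda>\<beta>. T \<alpha> \<beta> \<gamma>)) \<and> (\<forall>\<alpha> \<beta>. linear (\<lambda>\<gamma>. T \<alpha> \<beta> \<gamma>)) \<and>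
     (\<forall>\<alpha> \<beta> \<gamma>. T \<alpha> \<beta> \<gamma> = T \<beta> \<alpha> \<gamma> \<and> T \<alpha> \<beta> \<gamma> = T \<alpha> \<gamma> \<beta>) \<and>
     (\<forall>\<alpha> \<alpha>' \<beta> \<beta>' \<gamma> \<gamma>'.
        (\<forall>w\<in>W. blinfun_apply \<alpha> w = blinfun_apply \<alpha>' w \<and> blinfun_apply \<beta> w = blinfun_apply \<beta>' w \<and>
           blinfun_apply \<gamma> w = blinfun_apply \<gamma>' w) \<longrightarrow>
        T \<alpha> \<beta> \<gamma> = T \<alpha>' \<beta>' \<gamma>')}"

text \<open>
  The isomorphism from \<open>S\<^sup>3V\<close> to \<open>S\<^sup>3V\<^sup>*\<close> induced by \<open>v \<mapsto> \<omega> v _\<close>; it sends the product \<open>u v w\<close> to the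
  product of the functionals \<open>\<omega> u _\<close>, \<open>\<omega> v _\<close>, \<open>\<omega> w _\<close>, that is, evaluation at \<open>X\<close> is precomposed with
  \<open>v \<mapsto> \<omega> v _\<close>, giving the functional \<open>v \<mapsto> \<omega> v X\<close>.
\<close>

definition lower :: "('a::real_normed_vector \<Rightarrow> 'a \<Rightarrow> real) \<Rightarrow> 'a cubic \<Rightarrow> 'a \<Rightarrow> 'a \<Rightarrow> 'a \<Rightarrow> real" where
  "lower \<omega> T X Y Z = T (Blinfun (\<lambda>v. \<omega> v X)) (Blinfun (\<lambda>v. \<omega> v Y)) (Blinfun (\<lambda>v. \<omega> v Z))"

text \<open>
  The identification of \<open>S\<^sup>3V\<close> with the first prolongation of \<open>sp(V)\<close>, i.e. the symmetric bilinear maps \<open>S\<close>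
  with \<open>\<omega> (S X Y) Z + \<omega> Y (S X Z) = 0\<close>, in both directions.  The defining equation has exactly one solution
  on either side, since \<open>\<omega>\<close> is nondegenerate and \<open>X \<mapsto> \<omega> _ X\<close> is onto the dual space.
\<close>

definition tensor_of :: "('a::real_normed_vector \<Rightarrow> 'a \<Rightarrow> real) \<Rightarrow> ('a \<Rightarrow> 'a \<Rightarrow> 'a) \<Rightarrow> 'a cubic" where
  "tensor_of \<omega> S = (THE T. T \<in> S3 UNIV \<and> (\<forall>X Y Z. \<omega> (S X Y) Z = lower \<omega> T X Y Z))"

definition operator_of :: "('a::real_normed_vector \<Rightarrow> 'a \<Rightarrow> real) \<Rightarrow> 'a cubic \<Rightarrow> 'a \<Rightarrow> 'a \<Rightarrow> 'a" where
  "operator_of \<omega> T = (THE S. \<forall>X Y Z. \<omega> (S X Y) Z = lower \<omega> T X Y Z)"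

definition S3_reg :: "('a::real_normed_vector \<Rightarrow> 'a \<Rightarrow> real) \<Rightarrow> 'a set \<Rightarrow> 'a cubic set" where
  "S3_reg \<omega> W = {T \<in> S3 W. support (operator_of \<omega> T) = W}"

text \<open>The action of linear maps on cubic tensors: \<open>u v w \<mapsto> (g u) (g v) (g w)\<close>.\<close>

definition act :: "('a::real_normed_vector \<Rightarrow>\<^sub>L 'a) \<Rightarrow> 'a cubic \<Rightarrow> 'a cubic" where
  "act g T = (\<lambda>\<alpha> \<beta> \<gamma>. T (\<alpha> o\<^sub>L g) (\<beta> o\<^sub>L g) (\<gamma> o\<^sub>L g))"

text \<open>
  An element of \<open>GL(W)\<close> is represented by an extension \<open>g\<close> to \<open>V\<close>, not required to be invertible
  outside \<open>W\<close>; its action on \<open>S\<^sup>3W\<close> depends only on the restriction of \<open>g\<close> to \<open>W\<close>.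
\<close>

definition GL_rel :: "('a::real_normed_vector \<Rightarrow> 'a \<Rightarrow> real) \<Rightarrow> 'a set \<Rightarrow> ('a cubic \<times> 'a cubic) set" where
  "GL_rel \<omega> W = {(T, T'). T \<in> S3_reg \<omega> W \<and> T' \<in> S3_reg \<omega> W \<and>
     (\<exists>g :: 'a \<Rightarrow>\<^sub>L 'a. bij_betw (blinfun_apply g) W W \<and> T' = act g T)}"

text \<open>The elements of \<open>S\<^sup>3W\<^sub>r\<^sub>e\<^sub>g\<close> in the \<open>Sp(V)\<close>-orbit of the tensor attached to \<open>H\<close>.\<close>

definition cubics_of ::
  "('a::real_normed_vector \<Rightarrow> 'a \<Rightarrow> real) \<Rightarrow> 'a set \<Rightarrow> 'a affine_map set \<Rightarrow> 'a cubic set" where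
  "cubics_of \<omega> W H = {T \<in> S3_reg \<omega> W. \<exists>g \<in> Sp \<omega>. T = act g (tensor_of \<omega> (S_of \<omega> H))}"

end

theory Submission
  imports Defs
begin

text \<open>
  Commutativity turns the linear parts of \<open>H = {(I + S\<^sub>x, x)}\<close> into a symmetric, hence bilinear,
  expression \<open>S\<^sub>x y\<close>.  Comparing degrees in \<open>x\<close> in the condition that \<open>I + S\<^sub>x\<close> is symplectic yields
  \<open>S\<^sub>x \<in> sp(V)\<close> and \<open>S\<^sub>x S\<^sub>y = 0\<close>; so \<open>S\<close> is a cubic tensor with isotropic support, \<open>H\<close> is an affine
  subspace of the space of pairs, and the translations in \<open>H\<close> form the kernel of \<open>S\<close>, which is the
  \<open>\<omega>\<close>-complement of the support.  Conversely every cubic tensor with isotropic support arises in this way,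
  the Lie group structure being given by a single affine chart in which the group operations are quadratic.
  Conjugation acts on \<open>S\<close> through \<open>Sp(V)\<close>, and by Witt's theorem the \<open>Sp(V)\<close>-orbit meets the tensors with
  support \<open>W\<close> in exactly one \<open>GL(W)\<close>-orbit.
\<close>

section \<open>Symplectic linear algebra\<close>

text \<open>The vanishing of \<open>S_x S_y\<close> has two independent sources. The part of degree
  two of the symplectic condition gives only \<open>S_x S_x = 0\<close>, hence by polarization that
  the operators anticommute. Closure of \<open>H\<close> under multiplication gives
  \<open>S_x S_y = S_z\<close> for \<open>z = S_x y\<close>, and since \<open>S_x y = S_y x\<close>
  the operators commute as well. A consequence used everywhere is that \<open>S\<close> vanishes on
  its own support. It keeps the group operations quadratic, makes the support isotropic, and removes
  the influence of translations on conjugacy. The underlying type is an inner product space with a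
  finite spanning set, of a dimension that is not fixed by the type. Boundedness of linear maps and
  second countability are therefore obtained from the coordinates of an orthogonal spanning
  set.\<close>

lemma orthogonal_coordinates:
  fixes B :: "'a::real_inner set"
  assumes "finite B" and "span B = UNIV"
  obtains C where "finite C" and "\<And>x :: 'a. (\<Sum>c\<in>C. (x \<bullet> c / (c \<bullet> c)) *\<^sub>R c) = x"
proof -
  obtain C :: "'a set" where C: "finite C" "span C = UNIV" "pairwise orthogonal C"
    using basis_orthogonal[OF assms(1)] assms(2) by auto
  have "(\<Sum>c\<in>C. (x \<bullet> c / (c \<bullet> c)) *\<^sub>R c) = x" for x
  proof -
    \<comment> \<open>The defect of the expansion is orthogonal to a spanning set and therefore to
      itself. A zero vector in \<open>C\<close> does no harm, since its summand is zero.\<close>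
    define d where "d = x - (\<Sum>c\<in>C. (x \<bullet> c / (c \<bullet> c)) *\<^sub>R c)"
    have "orthogonal d e" if "e \<in> C" for e
    proof -
      have "(\<Sum>c\<in>C. (x \<bullet> c / (c \<bullet> c)) *\<^sub>R c) \<bullet> e = (\<Sum>c\<in>C. if c = e then x \<bullet> e else 0)"
        unfolding inner_sum_left
        using C(3) that by (intro sum.cong) (auto simp: pairwise_def orthogonal_def)
      then show ?thesis
        using C(1) that by (simp add: d_def orthogonal_def inner_diff_left)
    qed
    then have "orthogonal d d"
      using C(2) by (intro orthogonal_to_span[of d C d]) auto
    then show ?thesis
      by (simp add: d_def orthogonal_def)
  qed
  with C(1) that show thesis by blast
qed

text \<open>In orthogonal coordinates a linear map is a finite sum of fixed vectors scaled by inner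
  products, each of which is bounded.\<close>

lemma linear_imp_bounded_linear:
  fixes f :: "'a::real_inner \<Rightarrow> 'b::real_normed_vector"
  assumes "finite B" and "span B = (UNIV :: 'a set)" and "linear f"
  shows "bounded_linear f"
proof -
  obtain C where C: "\<And>x :: 'a. (\<Sum>c\<in>C. (x \<bullet> c / (c \<bullet> c)) *\<^sub>R c) = x"
    using orthogonal_coordinates[OF assms(1,2)] by metis
  have "f = (\<lambda>x. f (\<Sum>c\<in>C. (x \<bullet> c / (c \<bullet> c)) *\<^sub>R c))"
    by (simp add: C)
  also have "\<dots> = (\<lambda>x. \<Sum>c\<in>C. (x \<bullet> c / (c \<bullet> c)) *\<^sub>R f c)"
    using assms(3) by (simp add: linear_sum linear_cmul)
  finally have "f = (\<lambda>x. \<Sum>c\<in>C. (x \<bullet> c / (c \<bullet> c)) *\<^sub>R f c)" .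
  moreover have "bounded_linear (\<lambda>x. \<Sum>c\<in>C. (x \<bullet> c / (c \<bullet> c)) *\<^sub>R f c)"
    by (intro bounded_linear_sum bounded_linear_scaleR_left[THEN bounded_linear_compose]
        bounded_linear_divide[THEN bounded_linear_compose] bounded_linear_inner_left)
  ultimately show ?thesis by simp
qed

locale symplectic_space =
  fixes \<omega> :: "'a::real_inner \<Rightarrow> 'a \<Rightarrow> real" and E :: "'a set"
  assumes finite_E: "finite E" and independent_E: "independent E" and span_E: "span E = UNIV"
    and form: "symplectic_form \<omega>"
begin

text \<open>The rewrites restate the dimension theory in the type-class constants
  \<open>span\<close>, \<open>dim\<close> and \<open>linear\<close>, in which the theorem is
  phrased.\<close>

sublocale fd: finite_dimensional_vector_space "scaleR :: real \<Rightarrow> 'a \<Rightarrow> 'a" E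
  rewrites "module.dependent (*\<^sub>R) = dependent"
    and "module.representation (*\<^sub>R) = representation"
    and "module.subspace (*\<^sub>R) = subspace"
    and "module.span (*\<^sub>R) = span"
    and "vector_space.extend_basis (*\<^sub>R) = extend_basis"
    and "vector_space.dim (*\<^sub>R) = dim"
    and "Vector_Spaces.linear (*\<^sub>R) (*\<^sub>R) = linear"
    and "Vector_Spaces.linear (*) (*\<^sub>R) = linear"
proof -
  show "finite_dimensional_vector_space ((*\<^sub>R) :: real \<Rightarrow> 'a \<Rightarrow> 'a) E"
    by unfold_locales (use finite_E independent_E span_E in \<open>simp_all add: dependent_raw_def span_raw_def\<close>)
qed (auto simp add: dependent_raw_def representation_raw_def
      subspace_raw_def span_raw_def extend_basis_raw_def dim_raw_def linear_def
      real_scaleR_def[abs_def])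

sublocale fd1: finite_dimensional_vector_space_pair_1 "scaleR :: real \<Rightarrow> 'a \<Rightarrow> 'a" E "scaleR :: real \<Rightarrow> 'b::real_vector \<Rightarrow> 'b"
  rewrites "Vector_Spaces.linear (*\<^sub>R) (*\<^sub>R) = linear"
   and "vector_space.dim (*\<^sub>R) = dim"
    and "module.subspace (*\<^sub>R) = subspace"
    and "module.span (*\<^sub>R) = span"
  by unfold_locales (auto simp: linear_def dim_raw_def subspace_raw_def span_raw_def)
sublocale fd: finite_dimensional_vector_space_pair "scaleR :: real \<Rightarrow> 'a \<Rightarrow> 'a" E "scaleR :: real \<Rightarrow> 'a \<Rightarrow> 'a" E
  rewrites "Vector_Spaces.linear (*\<^sub>R) (*\<^sub>R) = linear"
   and "vector_space.dim (*\<^sub>R) = dim"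
    and "module.subspace (*\<^sub>R) = subspace"
    and "module.span (*\<^sub>R) = span"
  by unfold_locales (auto simp: linear_def dim_raw_def subspace_raw_def span_raw_def)

lemma bounded_linear: "linear f \<Longrightarrow> bounded_linear f" for f :: "'a \<Rightarrow> 'b::real_normed_vector"
  using linear_imp_bounded_linear[OF finite_E span_E] .

lemma bilinear_form: "bilinear \<omega>"
  and alternating [simp]: "\<omega> x x = 0"
  and nondegenerate: "(\<And>y. \<omega> x y = 0) \<Longrightarrow> x = 0"
  using form by (auto simp: symplectic_form_def)

lemma linear_form_left: "linear (\<lambda>x. \<omega> x y)"
  and linear_form_right: "linear (\<lambda>y. \<omega> x y)"
  using bilinear_form by (auto simp: bilinear_def)

lemmas form_simps = bilinear_ladd[OF bilinear_form] bilinear_radd[OF bilinear_form]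
  bilinear_lmul[OF bilinear_form] bilinear_rmul[OF bilinear_form]
  bilinear_lsub[OF bilinear_form] bilinear_rsub[OF bilinear_form]
  bilinear_lneg[OF bilinear_form] bilinear_rneg[OF bilinear_form]
  bilinear_lzero[OF bilinear_form] bilinear_rzero[OF bilinear_form]

lemma antisymmetric: "\<omega> y x = - \<omega> x y"
  using alternating[of "x + y"] by (simp add: form_simps del: alternating) (simp add: add_eq_0_iff)

lemma form_eqI: "(\<And>z. \<omega> x z = \<omega> y z) \<Longrightarrow> x = y"
  using nondegenerate[of "x - y"] by (simp add: form_simps)

text \<open>The map from \<open>V\<close> to its dual given by the form, in coordinates: the
  functional \<open>\<omega> v _\<close> is recorded by its values on \<open>B\<close>. The basis is
  a parameter because \<open>dim_perp\<close> needs one adapted to a subspace.\<close>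

definition form_map :: "'a set \<Rightarrow> 'a \<Rightarrow> 'a" where
  "form_map B v = (\<Sum>b\<in>B. \<omega> v b *\<^sub>R b)"

lemma linear_form_map: "linear (form_map B)"
  by (rule linearI) (simp_all add: form_map_def form_simps scaleR_left_distrib sum.distrib scaleR_sum_right)

lemma bij_form_map:
  assumes "finite B" and "independent B" and "span B = UNIV"
  shows "bij (form_map B)"
proof -
  have "v = 0" if "form_map B v = 0" for v
  proof (rule nondegenerate)
    fix y
    have "\<omega> v b = 0" if "b \<in> B" for b
      using independentD[OF assms(2,1) subset_refl] \<open>form_map B v = 0\<close> that by (simp add: form_map_def)
    then show "\<omega> v y = 0"
      using linear_eq_on_span[OF linear_form_right, of "\<lambda>_. 0" B v y] assms(3)
      by (auto simp: linear_zero)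
  qed
  then have "inj (form_map B)"
    by (simp add: linear_injective_0[OF linear_form_map])
  then show ?thesis
    using fd.linear_inj_imp_surj[OF linear_form_map] by (simp add: bij_def)
qed

lemma representable:
  assumes "linear \<alpha>"
  obtains v where "\<And>x. \<omega> v x = \<alpha> x"
proof -
  obtain v where v: "form_map E v = (\<Sum>b\<in>E. \<alpha> b *\<^sub>R b)"
    using bij_form_map[OF finite_E independent_E span_E] by (metis bij_pointE)
  have "(\<Sum>b\<in>E. (\<omega> v b - \<alpha> b) *\<^sub>R b) = 0"
    using v by (simp add: form_map_def scaleR_diff_left sum_subtractf)
  then have "\<omega> v b = \<alpha> b" if "b \<in> E" for b
    using independentD[OF independent_E finite_E subset_refl, of "\<lambda>b. \<omega> v b - \<alpha> b"] that by simp
  then have "\<omega> v x = \<alpha> x" for x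
    using linear_eq_on_span[OF linear_form_right assms, of E] span_E by auto
  with that show thesis by blast
qed

section \<open>Complements with respect to the symplectic form\<close>

definition perp :: "'a set \<Rightarrow> 'a set" where
  "perp U = {v. \<forall>u\<in>U. \<omega> v u = 0}"

lemma subspace_perp: "subspace (perp U)"
  by (simp add: perp_def subspace_def form_simps)

text \<open>Let the basis \<open>B\<close> of \<open>V\<close> extend a basis \<open>F\<close> of
  \<open>U\<close>. A vector lies in \<open>perp U\<close> exactly if its image under
  \<open>form_map B\<close> has no coordinates along \<open>F\<close>, so \<open>form_map B\<close>
  carries \<open>perp U\<close> onto \<open>span (B - F)\<close>.\<close>

lemma dim_perp:
  assumes "subspace U"
  shows "dim (perp U) + dim U = dim (UNIV :: 'a set)"
proof -
  obtain F where F: "F \<subseteq> U" "independent F" "span F = U" "card F = dim U"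
    using fd.basis_subspace_exists[OF assms] by metis
  obtain B where B: "F \<subseteq> B" "independent B" "span B = UNIV"
    using maximal_independent_subset_extend[OF subset_UNIV F(2)] by (metis UNIV_I subset_antisym subsetI subset_UNIV)
  have fin: "finite B"
    using B(2) by (rule fd.finiteI_independent)
  note bij = bij_form_map[OF fin B(2,3)]
  have "form_map B v \<in> span (B - F)" if "v \<in> perp U" for v
  proof -
    have "form_map B v = (\<Sum>b\<in>B - F. \<omega> v b *\<^sub>R b)"
      unfolding form_map_def using that F(1) fin by (intro sum.mono_neutral_right) (auto simp: perp_def)
    then show ?thesis
      by (metis (no_types, lifting) span_sum span_scale span_base)
  qed
  moreover have "y \<in> form_map B ` perp U" if "y \<in> span (B - F)" for y
  proof -
    obtain v where v: "form_map B v = y"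
      using bij by (metis bij_pointE)
    have "y \<in> range (\<lambda>c. \<Sum>b\<in>B - F. c b *\<^sub>R b)"
      using that span_finite[of "B - F"] fin by simp
    then obtain c where c: "y = (\<Sum>b\<in>B - F. c b *\<^sub>R b)"
      by (rule rangeE)
    have "y = (\<Sum>b\<in>B. (if b \<in> F then 0 else c b) *\<^sub>R b)"
      unfolding c using fin by (intro sum.mono_neutral_cong_left) auto
    then have "(\<Sum>b\<in>B. (\<omega> v b - (if b \<in> F then 0 else c b)) *\<^sub>R b) = 0"
      using v by (simp add: form_map_def scaleR_diff_left sum_subtractf)
    then have "\<omega> v b = 0" if "b \<in> F" for b
      using independentD[OF B(2) fin subset_refl, of "\<lambda>b. \<omega> v b - (if b \<in> F then 0 else c b)" b] that B(1) by auto
    then have "v \<in> perp U"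
      using linear_eq_on_span[OF linear_form_right, of "\<lambda>_. 0" F v] F(3)
      by (auto simp: linear_zero perp_def)
    with v show ?thesis by blast
  qed
  ultimately have "form_map B ` perp U = span (B - F)"
    by blast
  then have "dim (perp U) = dim (span (B - F))"
    using fd1.dim_image_eq[OF linear_form_map, OF inj_on_subset[OF bij_is_inj[OF bij] subset_UNIV]] by metis
  also have "\<dots> = card (B - F)"
    using B(2) by (metis Diff_subset dim_span_eq_card_independent independent_mono)
  also have "\<dots> = dim (UNIV :: 'a set) - dim U"
    using B F(4) fin by (metis card_Diff_subset dim_span_eq_card_independent finite_subset)
  finally show ?thesis
    using fd.dim_subset[OF subset_UNIV, of U] by simp
qed

section \<open>Witt's extension theorem\<close>

text \<open>The vector \<open>y\<close> has to represent, on the image of \<open>U\<close>, the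
  functional that \<open>x\<close> represents on \<open>U\<close>. The solutions form a coset of the
  complement of that image, and the point is to find one outside the image.\<close>

lemma extend_isometry_step:
  assumes U: "subspace U" and g: "linear g" "inj_on g U" "\<And>x y. x \<in> U \<Longrightarrow> y \<in> U \<Longrightarrow> \<omega> (g x) (g y) = \<omega> x y"
    and x: "x \<notin> U"
  obtains y where "y \<notin> g ` U" and "\<And>u. u \<in> U \<Longrightarrow> \<omega> y (g u) = \<omega> x u"
proof -
  obtain l where l: "linear l" "\<And>u. u \<in> U \<Longrightarrow> l (g u) = u"
    using real_vector.linear_exists_left_inverse_on[OF g(1) U g(2)] by auto
  \<comment> \<open>The left inverse \<open>l\<close> extends the transported functional to all of
    \<open>V\<close>, so that it can be represented.\<close>
  have "linear (\<lambda>z. \<omega> x (l z))"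
    using linear_compose[OF l(1) linear_form_right[of x]] by (simp add: o_def)
  then obtain y0 where y0: "\<And>z. \<omega> y0 z = \<omega> x (l z)"
    using representable by blast
  show thesis
  proof (cases "y0 \<in> g ` U")
    case False
    then show thesis using that[of y0] y0 l by simp
  next
    case True
    then obtain u0 where u0: "u0 \<in> U" "y0 = g u0" by blast
    \<comment> \<open>\<open>x\<close> and \<open>u0\<close> pair equally with \<open>U\<close>, so
      \<open>x - u0\<close> witnesses that \<open>perp U\<close> is not contained in
      \<open>U\<close>.\<close>
    have "x - u0 \<in> perp U"
      using u0 y0 l g(3) by (auto simp: perp_def form_simps) (metis)
    moreover have "x - u0 \<notin> U"
      using x u0 U by (metis diff_add_cancel subspace_add)
    ultimately have less: "U \<inter> perp U \<subset> perp U"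
      by blast
    have gU: "subspace (g ` U)" "dim (g ` U) = dim U"
      using linear_subspace_image[OF g(1) U] fd1.dim_image_eq[OF g(1), of U] g(2) U by (simp_all add: span_eq_iff[THEN iffD2])
    \<comment> \<open>Otherwise the complement of \<open>g ` U\<close> is its radical, which has the dimension of the radical of \<open>U\<close>,
      smaller than that of \<open>perp U\<close>.\<close>
    have "\<not> perp (g ` U) \<subseteq> g ` U"
    proof
      assume "perp (g ` U) \<subseteq> g ` U"
      then have "perp (g ` U) \<subseteq> g ` (U \<inter> perp U)"
        using g(3) by (auto simp: perp_def)
      then have "dim (perp (g ` U)) \<le> dim (g ` (U \<inter> perp U))"
        by (rule fd.dim_subset)
      also have "\<dots> \<le> dim (U \<inter> perp U)"
        by (rule fd1.dim_image_le[OF g(1)])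
      also have "\<dots> < dim (perp U)"
        using less U subspace_perp[of U] fd.dim_psubset[of "U \<inter> perp U" "perp U"]
        by (simp add: span_eq_iff[THEN iffD2] subspace_inter)
      also have "\<dots> = dim (perp (g ` U))"
        using dim_perp[OF U] dim_perp[OF gU(1)] gU(2) by simp
      finally show False by simp
    qed
    then obtain z where z: "z \<in> perp (g ` U)" "z \<notin> g ` U" by blast
    have "y0 + z \<notin> g ` U"
      using z(2) True gU(1) by (metis add_diff_cancel_left' subspace_diff)
    then show thesis
      using that[of "y0 + z"] y0 l z(1) by (simp add: form_simps perp_def)
  qed
qed

text \<open>Induction on the codimension of \<open>U\<close>, adding one vector \<open>x\<close>
  with image \<open>y\<close> at a time. Only the pairings with \<open>U\<close> have to be matched,
  because \<open>\<omega> x x\<close> and \<open>\<omega> y y\<close> both vanish.\<close>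

lemma extend_isometry:
  assumes "subspace U" and "linear g" and "inj_on g U"
    and "\<And>x y. x \<in> U \<Longrightarrow> y \<in> U \<Longrightarrow> \<omega> (g x) (g y) = \<omega> x y"
  shows "\<exists>h. linear h \<and> (\<forall>x\<in>U. h x = g x) \<and> (\<forall>x y. \<omega> (h x) (h y) = \<omega> x y)"
  using assms
proof (induction "dim (UNIV :: 'a set) - dim U" arbitrary: U g rule: less_induct)
  case less
  show ?case
  proof (cases "U = UNIV")
    case True
    then show ?thesis using less.prems by auto
  next
    case False
    then obtain x where x: "x \<notin> U" by blast
    then obtain y where y: "y \<notin> g ` U" "\<And>u. u \<in> U \<Longrightarrow> \<omega> y (g u) = \<omega> x u"
      using extend_isometry_step[OF less.prems] by metis
    obtain F where F: "F \<subseteq> U" "independent F" "span F = U"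
      using fd.basis_subspace_exists[OF less.prems(1)] by metis
    have "independent (insert x F)"
      using F x by (simp add: independent_insert)
    then obtain g' where g': "linear g'" "\<And>v. v \<in> insert x F \<Longrightarrow> g' v = (if v = x then y else g v)"
      using real_vector.linear_independent_extend[of "insert x F" "\<lambda>v. if v = x then y else g v"] by blast
    have g'x: "g' x = y"
      using g'(2) by simp
    have g'U: "g' u = g u" if "u \<in> U" for u
      using linear_eq_on_span[OF g'(1) less.prems(2), of F u] g'(2) that F x by force
    define U' where "U' = span (insert x U)"
    have U': "\<exists>u c. u \<in> U \<and> v = u + c *\<^sub>R x" if "v \<in> U'" for v
      using that less.prems(1) unfolding U'_def span_insert by (auto simp: span_eq_iff[THEN iffD2] intro: diff_add_cancel[symmetric])
    have g'val: "g' (u + c *\<^sub>R x) = g u + c *\<^sub>R y" if "u \<in> U" for u c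
      using that g'(1) by (simp add: linear_add linear_cmul g'x g'U)
    have iso: "\<omega> (g' v) (g' w) = \<omega> v w" if v: "v \<in> U'" and w: "w \<in> U'" for v w
    proof -
      obtain u c u' c' where *: "u \<in> U" "u' \<in> U" "v = u + c *\<^sub>R x" "w = u' + c' *\<^sub>R x"
        using U'[OF v] U'[OF w] by blast
      have "\<omega> (g u) y = \<omega> u x"
        using y(2)[OF *(1)] antisymmetric[of x u] antisymmetric[of y "g u"] by simp
      then show ?thesis
        unfolding * using * less.prems(4) y(2) by (simp add: g'val form_simps)
    qed
    \<comment> \<open>Injectivity on the larger subspace is where the choice of \<open>y\<close>
      outside the image of \<open>U\<close> enters.\<close>
    have "v = 0" if v: "v \<in> U'" and g'v: "g' v = 0" for v
    proof -
      obtain u c where *: "u \<in> U" "v = u + c *\<^sub>R x"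
        using U'[OF v] by blast
      then have eq: "g u + c *\<^sub>R y = 0"
        using g'v g'val by simp
      have "c = 0"
      proof (rule ccontr)
        assume "c \<noteq> 0"
        then have "y = (1 / c) *\<^sub>R (c *\<^sub>R y)"
          by simp
        also have "c *\<^sub>R y = - g u"
          using eq by (simp add: eq_neg_iff_add_eq_0 add.commute)
        finally have "y = g ((1 / c) *\<^sub>R (- u))"
          using less.prems(2) by (simp add: linear_cmul linear_neg)
        then show False
          using y(1) * less.prems(1) by (metis image_eqI subspace_scale subspace_neg)
      qed
      then have "g u = g 0"
        using eq less.prems(2) by (simp add: linear_0)
      then have "u = 0"
        using less.prems(1,3) *(1) by (metis inj_onD subspace_0)
      with * \<open>c = 0\<close> show ?thesis by simp
    qed
    then have inj: "inj_on g' U'"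
      by (intro linear_inj_on_iff_eq_0[OF g'(1), THEN iffD2]) (auto simp: U'_def)
    have "U \<subset> U'"
      using x by (auto simp: U'_def intro: span_base)
    then have "dim U < dim U'"
      using less.prems(1) by (intro fd.dim_psubset) (auto simp: U'_def span_eq_iff[THEN iffD2])
    moreover have "dim U' \<le> dim (UNIV :: 'a set)"
      by (rule fd.dim_subset) simp
    ultimately have "dim (UNIV :: 'a set) - dim U' < dim (UNIV :: 'a set) - dim U"
      by simp
    from less.hyps[OF this _ g'(1) inj iso]
    obtain h where "linear h" "\<forall>x\<in>U'. h x = g' x" "\<forall>x y. \<omega> (h x) (h y) = \<omega> x y"
      by (auto simp: U'_def)
    then show ?thesis
      using g'U \<open>U \<subset> U'\<close> by (metis psubsetE subsetD)
  qed
qed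

end

section \<open>Smooth functions and single-chart manifolds\<close>

lemma C_k_const: "C_k k U (\<lambda>x. a)"
proof (induction k arbitrary: a)
  case (Suc k)
  have "frechet_derivative (\<lambda>x. a) (at x) v = 0" for x v :: 'a
    by (simp add: frechet_derivative_at[OF has_derivative_const, symmetric])
  then show ?case using Suc by simp
qed simp

lemma C_k_affine:
  assumes "bounded_linear l"
  shows "C_k k U (\<lambda>x. a + l x)"
proof -
  have D: "((\<lambda>x. a + l x) has_derivative l) (at x)" for x
    using assms by (auto intro!: derivative_eq_intros bounded_linear_imp_has_derivative)
  then have "frechet_derivative (\<lambda>x. a + l x) (at x) = l" for x
    by (rule frechet_derivative_at[symmetric])
  moreover have "continuous_on U (\<lambda>x. a + l x)"
    using assms by (intro continuous_intros linear_continuous_on)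
  ultimately show ?thesis
    using D by (cases k) (auto simp: C_k_const differentiable_def)
qed

text \<open>In each fixed direction the derivative is affine in the point, so all higher orders
  reduce to \<open>C_k_affine\<close>.\<close>

lemma C_k_quadratic:
  assumes l: "bounded_linear l" and b: "bounded_bilinear b"
  shows "C_k k U (\<lambda>x. a + l x + b x x)"
proof -
  have D: "((\<lambda>x. a + l x + b x x) has_derivative (\<lambda>v. l v + (b x v + b v x))) (at x)" for x
    using l by (auto intro!: derivative_eq_intros bounded_linear_imp_has_derivative
        bounded_bilinear.FDERIV[OF b])
  then have "frechet_derivative (\<lambda>x. a + l x + b x x) (at x) = (\<lambda>v. l v + (b x v + b v x))" for x
    by (rule frechet_derivative_at[symmetric])
  moreover have "C_k j U (\<lambda>x. l v + (b x v + b v x))" for j v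
    by (intro C_k_affine bounded_linear_add bounded_bilinear.bounded_linear_left[OF b]
        bounded_bilinear.bounded_linear_right[OF b])
  moreover have "continuous_on U (\<lambda>x. a + l x + b x x)"
    using D by (meson has_derivative_continuous continuous_at_imp_continuous_on)
  moreover have "(\<lambda>x. a + l x + b x x) differentiable at x" for x
    using D by (rule differentiableI)
  ultimately show ?thesis
    by (cases k) auto
qed

lemma smooth_on_affine:
  assumes "bounded_linear l" and "\<And>x. x \<in> S \<Longrightarrow> f x = a + l x"
  shows "smooth_on S f"
  unfolding smooth_on_def using C_k_affine[OF assms(1)] assms(2)
  by (intro ballI exI[of _ UNIV] exI[of _ "\<lambda>x. a + l x"]) auto

lemma smooth_on_quadratic:
  assumes "bounded_linear l" and "bounded_bilinear b" and "\<And>x. x \<in> S \<Longrightarrow> f x = a + l x + b x x"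
  shows "smooth_on S f"
  unfolding smooth_on_def using C_k_quadratic[OF assms(1,2)] assms(3)
  by (intro ballI exI[of _ UNIV] exI[of _ "\<lambda>x. a + l x + b x x"]) auto

lemma bounded_bilinear_compose_linear:
  assumes "bounded_linear f" and "bounded_bilinear b"
  shows "bounded_bilinear (\<lambda>x y. f (b x y))"
proof -
  obtain K L where K: "\<And>x. norm (f x) \<le> norm x * K" "0 < K" and L: "\<And>x y. norm (b x y) \<le> norm x * norm y * L"
    using bounded_linear.pos_bounded[OF assms(1)] bounded_bilinear.bounded[OF assms(2)] by blast
  have "norm (f (b x y)) \<le> norm x * norm y * (L * K)" for x y
    using order_trans[OF K(1) mult_right_mono[OF L]] K(2) by (simp add: mult.assoc)
  then show ?thesis
    using linear_simps[OF assms(1)] assms(2)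
    by unfold_locales (auto simp: bounded_bilinear.add_left bounded_bilinear.add_right
        bounded_bilinear.scaleR_left bounded_bilinear.scaleR_right)
qed

lemma second_countable_euclidean: "second_countable (euclidean :: 'a::second_countable_topology topology)"
proof -
  obtain B :: "'a set set" where "countable B" "topological_basis B"
    using ex_countable_basis by blast
  then show ?thesis
    unfolding second_countable_def
    by (intro exI[of _ B]) (metis open_openin topological_basis_open topological_basisE)
qed

text \<open>Coordinates embed the space into \<open>nat \<Rightarrow> real\<close>, which is second
  countable and has room for every finite dimension.\<close>

lemma second_countable_finite_dimensional:
  fixes B :: "'a::real_inner set"
  assumes "finite B" and "span B = UNIV"
  shows "second_countable (euclidean :: 'a topology)"
proof -
  obtain C where C: "finite C" "\<And>x :: 'a. (\<Sum>c\<in>C. (x \<bullet> c / (c \<bullet> c)) *\<^sub>R c) = x"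
    using orthogonal_coordinates[OF assms] by metis
  obtain e :: "nat \<Rightarrow> 'a" where e: "bij_betw e {0..<card C} C"
    using ex_bij_betw_nat_finite[OF C(1)] by blast
  \<comment> \<open>The vectors \<open>e i\<close> with \<open>i\<close> at least
    \<open>card C\<close> are unspecified; \<open>g\<close> ignores these coordinates.\<close>
  define f where "f x i = x \<bullet> e i" for x i
  define g where "g y = (\<Sum>i\<in>{0..<card C}. (y i / (e i \<bullet> e i)) *\<^sub>R e i)" for y :: "nat \<Rightarrow> real"
  have "g (f x) = x" for x
    using C(2)[of x] sum.reindex_bij_betw[OF e, of "\<lambda>c. (x \<bullet> c / (c \<bullet> c)) *\<^sub>R c"]
    by (simp add: f_def g_def)
  moreover have "continuous_on UNIV f"
    unfolding f_def by (intro continuous_on_coordinatewise_then_product continuous_intros)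
  moreover have "continuous_on UNIV g"
    unfolding g_def by (auto intro!: continuous_intros continuous_on_product_coordinates simp: divide_inverse)
  ultimately have "homeomorphic_maps euclidean (top_of_set (range f)) f g"
    using continuous_on_subset[of UNIV g "range f"]
    by (simp add: homeomorphic_maps_def continuous_map_in_subtopology)
  moreover have "second_countable (top_of_set (range f))"
    by (intro second_countable_subtopology second_countable_euclidean)
  ultimately show ?thesis
    using homeomorphic_space_second_countability[OF homeomorphic_maps_imp_homeomorphic_space] by blast
qed

text \<open>For one global chart onto the model the openness conditions are trivial, and the only
  transition map is the chart after its own inverse.\<close>

lemma smooth_manifold_single_chart:
  assumes "Hausdorff_space X" and "second_countable X" and "topspace X = G"
    and "finite B" and "A = span B" and "c ` G = A"
    and "homeomorphic_map X (top_of_set A) c" and "smooth_on A (c \<circ> inv_into G c)"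
  shows "smooth_manifold \<lparr>mtop = X, model = A, atlas = {(G, c)}\<rparr>"
  using assms subtopology_topspace[of X] openin_topspace[of X] unfolding smooth_manifold_def by auto

lemma immersion_single_chart:
  assumes "smooth_map \<lparr>mtop = X, model = A, atlas = {(G, c)}\<rparr> vector_manifold f" and "c ` G = A"
    and "\<And>p. p \<in> A \<Longrightarrow> (f \<circ> inv_into G c has_derivative D) (at p within A)" and "inj_on D A"
  shows "immersion \<lparr>mtop = X, model = A, atlas = {(G, c)}\<rparr> f"
  using assms unfolding immersion_def by auto

section \<open>Groups that are graphs over the translation part\<close>

text \<open>\<open>U\<close> is the whole space for the simply transitive group and the kernel of
  \<open>S\<close> for its translation subgroup.\<close>

definition graph_group :: "'a::real_normed_vector set \<Rightarrow> ('a \<Rightarrow> 'a \<Rightarrow>\<^sub>L 'a) \<Rightarrow> 'a affine_map set" where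
  "graph_group U S = (\<lambda>x. (id_blinfun + S x, x)) ` U"

definition graph_algebra :: "'a::real_normed_vector set \<Rightarrow> ('a \<Rightarrow> 'a \<Rightarrow>\<^sub>L 'a) \<Rightarrow> 'a affine_map set" where
  "graph_algebra U S = (\<lambda>x. (S x, x)) ` U"

text \<open>The model is a subspace of the space of pairs, as the type in
  \<open>Lie_subgroup\<close> demands; the chart merely moves the identity to the origin.\<close>

definition graph_manifold :: "'a::real_normed_vector set \<Rightarrow> ('a \<Rightarrow> 'a \<Rightarrow>\<^sub>L 'a) \<Rightarrow> ('a affine_map, 'a affine_map) manifold" where
  "graph_manifold U S = \<lparr>mtop = top_of_set (graph_group U S), model = graph_algebra U S,
     atlas = {(graph_group U S, \<lambda>h. h - (id_blinfun, 0))}\<rparr>"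

text \<open>An element of the first prolongation of sp(V) with isotropic support: by skewness
  \<open>\<omega> (S x (S y z)) w = - \<omega> (S y z) (S x w)\<close>, so the last clause expresses
  isotropy.\<close>

definition nilpotent_symbol :: "('a::real_normed_vector \<Rightarrow> 'a \<Rightarrow> real) \<Rightarrow> ('a \<Rightarrow> 'a \<Rightarrow>\<^sub>L 'a) \<Rightarrow> bool" where
  "nilpotent_symbol \<omega> S \<longleftrightarrow> linear S \<and> (\<forall>x y. S x y = S y x) \<and>
     (\<forall>x y z. \<omega> (S x y) z + \<omega> y (S x z) = 0) \<and> (\<forall>x y z. S x (S y z) = 0)"

context symplectic_space begin

lemma perp_perp:
  assumes "subspace U"
  shows "perp (perp U) = U"
proof (rule sym, rule fd.subspace_dim_equal[OF assms subspace_perp])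
  show "U \<subseteq> perp (perp U)"
  proof
    fix u assume "u \<in> U"
    then have "\<omega> u v = 0" if "v \<in> perp U" for v
      using that antisymmetric[of u v] by (simp add: perp_def)
    then show "u \<in> perp (perp U)"
      by (simp add: perp_def[of "perp U"])
  qed
  show "dim U \<ge> dim (perp (perp U))"
    using dim_perp[OF assms] dim_perp[OF subspace_perp, of U] by simp
qed

section \<open>The group of affine symplectic transformations\<close>

text \<open>Preserving a nondegenerate form forces injectivity, and finite dimension then gives
  surjectivity.\<close>

lemma Sp_inverse:
  assumes "A \<in> Sp \<omega>"
  obtains B where "B \<in> Sp \<omega>" and "A o\<^sub>L B = id_blinfun" and "B o\<^sub>L A = id_blinfun"
proof -
  have lin: "linear (blinfun_apply A)"
    by (simp add: blinfun.bounded_linear_right bounded_linear.linear)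
  have iso: "\<omega> (A x) (A y) = \<omega> x y" for x y
    using assms by (simp add: Sp_def)
  have "x = 0" if "A x = 0" for x
    using iso[of x] that by (intro nondegenerate) (simp add: form_simps)
  then have inj: "inj A"
    by (simp add: linear_injective_0[OF lin])
  then have surj: "surj A"
    by (rule fd.linear_inj_imp_surj[OF lin])
  define f where "f = inv_into UNIV A"
  have f: "linear f" "f (A x) = x" "A (f x) = x" for x
    using fd.inj_linear_imp_inv_linear[OF lin inj] inj surj by (simp_all add: f_def surj_f_inv_f)
  have B: "blinfun_apply (Blinfun f) = f"
    by (simp add: f(1) bounded_linear bounded_linear_Blinfun_apply)
  have "\<omega> (f x) (f y) = \<omega> x y" for x y
    using iso[of "f x" "f y"] by (simp add: f)
  then have "Blinfun f \<in> Sp \<omega>"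
    by (simp add: Sp_def B)
  moreover have "A o\<^sub>L Blinfun f = id_blinfun" "Blinfun f o\<^sub>L A = id_blinfun"
    by (rule blinfun_eqI, simp add: B f)+
  ultimately show thesis
    by (rule that)
qed

lemma surj_Sp: "g \<in> Sp \<omega> \<Longrightarrow> surj g"
  using Sp_inverse by (metis blinfun_apply_blinfun_compose id_blinfun.rep_eq surjI)

lemma Sp_compose: "A \<in> Sp \<omega> \<Longrightarrow> B \<in> Sp \<omega> \<Longrightarrow> A o\<^sub>L B \<in> Sp \<omega>"
  by (simp add: Sp_def)

lemma id_Sp: "id_blinfun \<in> Sp \<omega>"
  by (simp add: Sp_def)

lemma AffSp_simps [simp]:
  "carrier (AffSp \<omega>) = Sp \<omega> \<times> UNIV"
  "\<one>\<^bsub>AffSp \<omega>\<^esub> = (id_blinfun, 0)"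
  "(A, v) \<otimes>\<^bsub>AffSp \<omega>\<^esub> (B, w) = (A o\<^sub>L B, A w + v)"
  by (simp_all add: AffSp_def)

lemma group_AffSp: "group (AffSp \<omega>)"
proof (rule groupI)
  fix g assume "g \<in> carrier (AffSp \<omega>)"
  then obtain A v where g: "g = (A, v)" "A \<in> Sp \<omega>" by auto
  then obtain B where "B \<in> Sp \<omega>" "B o\<^sub>L A = id_blinfun"
    using Sp_inverse by metis
  then show "\<exists>h\<in>carrier (AffSp \<omega>). h \<otimes>\<^bsub>AffSp \<omega>\<^esub> g = \<one>\<^bsub>AffSp \<omega>\<^esub>"
    unfolding g by (intro bexI[of _ "(B, - B v)"]) auto
qed (auto simp: Sp_compose id_Sp blinfun.add_right intro!: blinfun_eqI)

end

locale nilpotent = symplectic_space \<omega> E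
  for \<omega> :: "'a::real_inner \<Rightarrow> 'a \<Rightarrow> real" and E +
  fixes S :: "'a \<Rightarrow> 'a \<Rightarrow>\<^sub>L 'a"
  assumes nil: "nilpotent_symbol \<omega> S"
begin

lemma linear_S: "linear S"
  and S_commute: "S x y = S y x"
  and S_form: "\<omega> (S x y) z + \<omega> y (S x z) = 0"
  and S_S [simp]: "S x (S y z) = 0"
  using nil unfolding nilpotent_symbol_def by blast+

lemmas S_simps = linear_add[OF linear_S] linear_cmul[OF linear_S] linear_0[OF linear_S]
  linear_neg[OF linear_S] linear_diff[OF linear_S]

lemma bounded_linear_S: "bounded_linear S"
  by (rule bounded_linear[OF linear_S])

text \<open>Symmetry turns \<open>S (S x y) z\<close> into \<open>S z (S x y)\<close>.\<close>

lemma S_at_S [simp]: "S (S x y) = 0"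
proof (rule blinfun_eqI)
  show "S (S x y) z = blinfun_apply 0 z" for z
    using S_commute[of "S x y" z] by simp
qed

text \<open>Both linear parts are the identity plus \<open>S x + S y\<close>: the product of
  \<open>S x\<close> and \<open>S y\<close> vanishes on the left, \<open>S (S x y)\<close> on the
  right. The group law differs from addition by the bilinear term \<open>S x y\<close>.\<close>

lemma graph_mult:
  "(id_blinfun + S x, x) \<otimes>\<^bsub>AffSp \<omega>\<^esub> (id_blinfun + S y, y) =
   (id_blinfun + S (x + y + S x y), x + y + S x y)"
proof -
  have "(id_blinfun + S x) o\<^sub>L (id_blinfun + S y) = id_blinfun + S (x + y + S x y)"
    by (rule blinfun_eqI) (simp add: S_simps blinfun.add_left blinfun.add_right)
  then show ?thesis
    by (simp add: blinfun.add_left add_ac)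
qed

text \<open>The linear term cancels by skewness, and the quadratic term is
  \<open>- \<omega> y (S x (S x z))\<close>.\<close>

lemma graph_Sp: "id_blinfun + S x \<in> Sp \<omega>"
proof -
  have "\<omega> (S x y) z + \<omega> y (S x z) = 0" "\<omega> (S x y) (S x z) = 0" for y z
    using S_form[of x y z] S_form[of x y "S x z"] by (simp_all add: form_simps)
  then show ?thesis
    by (simp add: Sp_def blinfun.add_left form_simps algebra_simps)
qed

text \<open>The parameter of the inverse is the \<open>y\<close> that solves
  \<open>y + x + S y x = 0\<close>.\<close>

lemma graph_inv:
  "inv\<^bsub>AffSp \<omega>\<^esub> (id_blinfun + S x, x) = (id_blinfun + S (S x x - x), S x x - x)"
proof (rule group.inv_equality[OF group_AffSp])
  show "(id_blinfun + S (S x x - x), S x x - x) \<otimes>\<^bsub>AffSp \<omega>\<^esub> (id_blinfun + S x, x) = \<one>\<^bsub>AffSp \<omega>\<^esub>"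
    unfolding graph_mult by (simp add: S_simps blinfun.minus_left)
qed (simp_all add: graph_Sp del: S_at_S)

lemma subgroup_graph:
  assumes "subspace U" and "\<And>x y. x \<in> U \<Longrightarrow> y \<in> U \<Longrightarrow> S x y \<in> U"
  shows "subgroup (graph_group U S) (AffSp \<omega>)"
proof
  have graph: "(id_blinfun + S x, x) \<in> graph_group U S" if "x \<in> U" for x
    using that by (simp add: graph_group_def)
  show "graph_group U S \<subseteq> carrier (AffSp \<omega>)"
    using graph_Sp by (auto simp: graph_group_def)
  show "\<one>\<^bsub>AffSp \<omega>\<^esub> \<in> graph_group U S"
    using graph[OF subspace_0[OF assms(1)]] by (simp add: S_simps)
  fix g assume "g \<in> graph_group U S"
  then obtain x where x: "x \<in> U" "g = (id_blinfun + S x, x)"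
    by (auto simp: graph_group_def)
  show "inv\<^bsub>AffSp \<omega>\<^esub> g \<in> graph_group U S"
    unfolding x(2) graph_inv using x(1) assms by (intro graph subspace_diff)
  fix h assume "h \<in> graph_group U S"
  then obtain y where y: "y \<in> U" "h = (id_blinfun + S y, y)"
    by (auto simp: graph_group_def)
  show "g \<otimes>\<^bsub>AffSp \<omega>\<^esub> h \<in> graph_group U S"
    unfolding x(2) y(2) graph_mult using x(1) y(1) assms by (intro graph subspace_add)
qed

section \<open>The Lie group structure on a graph\<close>

lemma bounded_linear_graph: "bounded_linear (\<lambda>x. (S x, x))"
  by (intro bounded_linear_Pair bounded_linear_S bounded_linear_ident)

lemma chart_graph: "(\<lambda>h. h - (id_blinfun, 0)) ` graph_group U S = graph_algebra U S"
  by (simp add: graph_group_def graph_algebra_def image_image)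

lemma inv_chart_graph:
  "p \<in> graph_algebra U S \<Longrightarrow> inv_into (graph_group U S) (\<lambda>h. h - (id_blinfun, 0)) p = p + (id_blinfun, 0)"
  by (rule inv_into_f_eq) (auto simp: graph_group_def graph_algebra_def inj_on_def)

lemma smooth_manifold_graph:
  assumes "subspace U"
  shows "smooth_manifold (graph_manifold U S)"
proof -
  have "continuous_on U (\<lambda>x. (id_blinfun + S x, x))"
    by (intro continuous_intros linear_continuous_on bounded_linear_S)
  moreover have "continuous_on (graph_group U S) snd"
    by (intro continuous_intros)
  ultimately have "homeomorphic_maps (top_of_set U) (top_of_set (graph_group U S)) (\<lambda>x. (id_blinfun + S x, x)) snd"
    unfolding homeomorphic_maps_def continuous_map_in_subtopology by (auto simp: graph_group_def)
  then have "top_of_set U homeomorphic_space top_of_set (graph_group U S)"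
    by (rule homeomorphic_maps_imp_homeomorphic_space)
  \<comment> \<open>Second countability is inherited from \<open>V\<close> along the homeomorphism
    with \<open>U\<close>.\<close>
  then have second_countable: "second_countable (top_of_set (graph_group U S))"
    by (rule iffD1[OF homeomorphic_space_second_countability])
      (rule second_countable_subtopology[OF second_countable_finite_dimensional[OF finite_E span_E]])
  obtain F where F: "finite F" "span F = U"
    using fd.basis_subspace_exists[OF assms] by metis
  have model: "graph_algebra U S = span ((\<lambda>x. (S x, x)) ` F)"
    using span_linear_image[OF bounded_linear.linear[OF bounded_linear_graph], of F] F(2)
    by (simp add: graph_algebra_def)
  have chart: "homeomorphic_map (top_of_set (graph_group U S)) (top_of_set (graph_algebra U S)) (\<lambda>h. h - (id_blinfun, 0))"
    unfolding homeomorphic_map_maps homeomorphic_maps_def continuous_map_in_subtopology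
    by (rule exI[of _ "\<lambda>p. p + (id_blinfun, 0)"])
      (auto simp: graph_group_def graph_algebra_def intro!: continuous_intros)
  have smooth: "smooth_on (graph_algebra U S) ((\<lambda>h. h - (id_blinfun, 0)) \<circ> inv_into (graph_group U S) (\<lambda>h. h - (id_blinfun, 0)))"
    by (rule smooth_on_affine[OF bounded_linear_ident, of _ _ 0]) (simp add: inv_chart_graph)
  have Hausdorff: "Hausdorff_space (top_of_set (graph_group U S))"
    by (intro Hausdorff_space_subtopology Hausdorff_space_euclidean)
  show ?thesis
    unfolding graph_manifold_def
    using finite_imageI[OF F(1)]
    by (rule smooth_manifold_single_chart[OF Hausdorff second_countable topspace_euclidean_subtopology
          _ model chart_graph chart smooth])
qed

lemma smooth_map_graph_mult:
  assumes "subspace U" and "\<And>x y. x \<in> U \<Longrightarrow> y \<in> U \<Longrightarrow> S x y \<in> U"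
  shows "smooth_map (prod_manifold (graph_manifold U S) (graph_manifold U S)) (graph_manifold U S)
    (\<lambda>(g, h). g \<otimes>\<^bsub>AffSp \<omega>\<^esub> h)"
proof -
  let ?G = "graph_group U S" and ?A = "graph_algebra U S" and ?c = "\<lambda>h :: 'a affine_map. h - (id_blinfun, 0)"
  let ?m = "\<lambda>(g, h). g \<otimes>\<^bsub>AffSp \<omega>\<^esub> h"
  have closed: "?m p \<in> ?G" if "p \<in> ?G \<times> ?G" for p
    using that subgroup.m_closed[OF subgroup_graph[OF assms]] by auto
  have "continuous_on (?G \<times> ?G) ?m"
    by (auto simp: AffSp_def case_prod_unfold intro!: continuous_intros)
  then have "continuous_map (top_of_set (?G \<times> ?G)) (top_of_set ?G) ?m"
    using closed by (auto simp: continuous_map_in_subtopology)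
  moreover have img: "map_prod ?c ?c ` (?G \<times> ?G \<inter> ?m -` ?G) = ?A \<times> ?A"
  proof -
    have "?G \<times> ?G \<inter> ?m -` ?G = ?G \<times> ?G"
      using closed by auto
    then show ?thesis
      using map_prod_surj_on[OF chart_graph chart_graph] by metis
  qed
  moreover have "smooth_on (?A \<times> ?A) (?c \<circ> ?m \<circ> inv_into (?G \<times> ?G) (map_prod ?c ?c))"
  proof (rule smooth_on_quadratic)
    show "bounded_linear (\<lambda>p :: 'a affine_map \<times> 'a affine_map. fst p + snd p)"
      by (intro bounded_linear_add bounded_linear_fst bounded_linear_snd)
    \<comment> \<open>The term \<open>S x y\<close> of the group law as a bilinear map: the linear
      part of the first factor is read from one argument, the translation part of the second factor
      from the other.\<close>
    show "bounded_bilinear (\<lambda>p q :: 'a affine_map \<times> 'a affine_map. (0 :: 'a \<Rightarrow>\<^sub>L 'a, blinfun_apply (fst (fst p)) (snd (snd q))))"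
      by (intro bounded_bilinear_compose_linear[of "\<lambda>v. (0, v)"] bounded_linear_Pair bounded_linear_zero bounded_linear_ident
          bounded_bilinear.comp[OF bounded_bilinear_blinfun_apply, of "\<lambda>p. fst (fst p)" "\<lambda>q. snd (snd q)"]
          bounded_linear_compose[OF bounded_linear_fst] bounded_linear_compose[OF bounded_linear_snd]
          bounded_linear_fst bounded_linear_snd)
    fix p assume "p \<in> ?A \<times> ?A"
    then obtain x y where x: "x \<in> U" and y: "y \<in> U" and p: "p = ((S x, x), (S y, y))"
      by (auto simp: graph_algebra_def)
    have "inv_into (?G \<times> ?G) (map_prod ?c ?c) p = ((id_blinfun + S x, x), (id_blinfun + S y, y))"
      using x y by (intro inv_into_f_eq) (auto simp: p graph_group_def inj_on_def)
    then show "(?c \<circ> ?m \<circ> inv_into (?G \<times> ?G) (map_prod ?c ?c)) p = 0 + (fst p + snd p) + (0, blinfun_apply (fst (fst p)) (snd (snd p)))"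
      by (simp add: p graph_mult S_simps del: AffSp_simps(3))
  qed
  ultimately show ?thesis
    by (simp add: smooth_map_def prod_manifold_def graph_manifold_def)
qed

lemma smooth_map_graph_inv:
  assumes "subspace U" and "\<And>x y. x \<in> U \<Longrightarrow> y \<in> U \<Longrightarrow> S x y \<in> U"
  shows "smooth_map (graph_manifold U S) (graph_manifold U S) (\<lambda>g. inv\<^bsub>AffSp \<omega>\<^esub> g)"
proof -
  let ?G = "graph_group U S" and ?A = "graph_algebra U S" and ?c = "\<lambda>h :: 'a affine_map. h - (id_blinfun, 0)"
  let ?m = "\<lambda>g. inv\<^bsub>AffSp \<omega>\<^esub> g"
  have closed: "?m p \<in> ?G" if "p \<in> ?G" for p
    using that subgroup.m_inv_closed[OF subgroup_graph[OF assms]] by auto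
  \<comment> \<open>Since \<open>S (S x x - x) = - S x\<close>, the inverse can be written in terms
    of \<open>A\<close> and \<open>v\<close> alone, which makes its continuity visible.\<close>
  have m: "?m (A, v) = (id_blinfun + id_blinfun - A, A v - v - v)" if "(A, v) \<in> ?G" for A v
    using that by (auto simp: graph_group_def graph_inv S_simps blinfun.add_left)
  have "continuous_on ?G (\<lambda>p. (id_blinfun + id_blinfun - fst p, blinfun_apply (fst p) (snd p) - snd p - snd p))"
    by (intro continuous_intros)
  then have "continuous_on ?G ?m"
    by (rule continuous_on_eq) (auto simp: m)
  then have "continuous_map (top_of_set ?G) (top_of_set ?G) ?m"
    using closed by (auto simp: continuous_map_in_subtopology)
  moreover have img: "?c ` (?G \<inter> ?m -` ?G) = ?A"
  proof -
    have "?G \<inter> ?m -` ?G = ?G"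
      using closed by auto
    then show ?thesis
      using chart_graph by metis
  qed
  moreover have "smooth_on ?A (?c \<circ> ?m \<circ> inv_into ?G ?c)"
  proof (rule smooth_on_quadratic)
    show "bounded_linear (\<lambda>p :: 'a affine_map. - p)"
      by (intro bounded_linear_minus bounded_linear_ident)
    show "bounded_bilinear (\<lambda>p q :: 'a affine_map. (0 :: 'a \<Rightarrow>\<^sub>L 'a, blinfun_apply (fst p) (snd q)))"
      by (intro bounded_bilinear_compose_linear[of "\<lambda>v. (0, v)"] bounded_linear_Pair bounded_linear_zero bounded_linear_ident
          bounded_bilinear.comp[OF bounded_bilinear_blinfun_apply] bounded_linear_fst bounded_linear_snd)
    fix p assume "p \<in> ?A"
    then obtain x where x: "x \<in> U" and p: "p = (S x, x)"
      by (auto simp: graph_algebra_def)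
    then show "(?c \<circ> ?m \<circ> inv_into ?G ?c) p = 0 + - p + (0, blinfun_apply (fst p) (snd p))"
      by (simp add: graph_algebra_def inv_chart_graph graph_inv S_simps add.commute[of "S x"])
  qed
  ultimately show ?thesis
    by (simp add: smooth_map_def graph_manifold_def)
qed

lemma smooth_map_from_graph:
  assumes "bounded_linear l"
  shows "smooth_map (graph_manifold U S) vector_manifold l"
proof -
  have "smooth_on (graph_algebra U S) (l \<circ> inv_into (graph_group U S) (\<lambda>h. h - (id_blinfun, 0)))"
    by (rule smooth_on_affine[OF assms, of _ _ "l (id_blinfun, 0)"])
      (simp only: o_def inv_chart_graph linear_simps(1)[OF assms] add.commute)
  then show ?thesis
    using assms by (simp add: smooth_map_def graph_manifold_def vector_manifold_def chart_graph linear_continuous_on)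
qed

text \<open>Serves twice: with the identity it gives the inverse of the orbit map, with
  \<open>t \<mapsto> t *\<^sub>R v\<close> the curves that realize the Lie algebra.\<close>

lemma smooth_map_to_graph:
  fixes x :: "'b::real_normed_vector \<Rightarrow> 'a"
  assumes "bounded_linear x" and "range x \<subseteq> U"
  shows "smooth_map vector_manifold (graph_manifold U S) (\<lambda>t. (id_blinfun + S (x t), x t))"
proof -
  have "bounded_linear (\<lambda>t. (S (x t), x t))"
    by (intro bounded_linear_Pair bounded_linear_compose[OF bounded_linear_S] assms)
  moreover have "continuous_on UNIV (\<lambda>t. (id_blinfun + S (x t), x t))"
    by (intro continuous_intros linear_continuous_on bounded_linear_compose[OF bounded_linear_S] assms)
  moreover have "(\<lambda>t. (id_blinfun + S (x t), x t)) \<in> UNIV \<rightarrow> graph_group U S"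
    using assms(2) by (auto simp: graph_group_def)
  ultimately show ?thesis
    unfolding smooth_map_def graph_manifold_def vector_manifold_def
    by (auto simp: continuous_map_in_subtopology intro!: smooth_on_affine[of "\<lambda>t. (S (x t), x t)" _ _ 0])
qed

lemma immersion_graph: "immersion (graph_manifold U S) (\<lambda>h. h)"
  unfolding graph_manifold_def
proof (rule immersion_single_chart[where D = "\<lambda>p. p"])
  show "smooth_map \<lparr>mtop = top_of_set (graph_group U S), model = graph_algebra U S,
      atlas = {(graph_group U S, \<lambda>h. h - (id_blinfun, 0))}\<rparr> vector_manifold (\<lambda>h. h)"
    using smooth_map_from_graph[OF bounded_linear_ident, of U] by (simp only: graph_manifold_def)
  fix p assume p: "p \<in> graph_algebra U S"
  show "((\<lambda>h. h) \<circ> inv_into (graph_group U S) (\<lambda>h. h - (id_blinfun, 0)) has_derivative (\<lambda>p. p))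
    (at p within graph_algebra U S)"
    by (rule has_derivative_transform[OF p, where f = "\<lambda>p. p + (id_blinfun, 0)"])
      (auto simp: inv_chart_graph intro!: derivative_eq_intros)
qed (rule chart_graph, simp)

lemma Lie_subgroup_graph:
  assumes "subspace U" and "\<And>x y. x \<in> U \<Longrightarrow> y \<in> U \<Longrightarrow> S x y \<in> U"
  shows "Lie_subgroup \<omega> (graph_manifold U S) (graph_group U S)"
  using subgroup_graph smooth_manifold_graph smooth_map_graph_mult smooth_map_graph_inv immersion_graph assms
  by (simp add: Lie_subgroup_def) (simp add: graph_manifold_def)

section \<open>Lie algebra, translations and support of a graph group\<close>

text \<open>\<open>Lie_algebra\<close> ranges over all Lie group structures on the set. For each of
  them a smooth curve stays in the affine subspace formed by the group, and a bounded linear map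
  that is constant on this subspace kills the velocity.\<close>

lemma Lie_algebra_graph:
  assumes "subspace U" and "\<And>x y. x \<in> U \<Longrightarrow> y \<in> U \<Longrightarrow> S x y \<in> U"
  shows "Lie_algebra \<omega> (graph_group U S) = graph_algebra U S"
proof
  show "graph_algebra U S \<subseteq> Lie_algebra \<omega> (graph_group U S)"
  proof
    fix \<xi> assume "\<xi> \<in> graph_algebra U S"
    then obtain v where v: "v \<in> U" "\<xi> = (S v, v)"
      by (auto simp: graph_algebra_def)
    let ?\<gamma> = "\<lambda>t. (id_blinfun + S (t *\<^sub>R v), t *\<^sub>R v)"
    have "smooth_map (vector_manifold :: (real, real) manifold) (graph_manifold U S) ?\<gamma>"
      using v(1) assms(1) by (intro smooth_map_to_graph bounded_linear_scaleR_left) (auto simp: subspace_scale)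
    moreover have "(?\<gamma> has_vector_derivative \<xi>) (at 0)"
      unfolding v(2) S_simps by (auto intro!: derivative_eq_intros)
    moreover have "?\<gamma> 0 = \<one>\<^bsub>AffSp \<omega>\<^esub>"
      by (simp add: S_simps)
    ultimately show "\<xi> \<in> Lie_algebra \<omega> (graph_group U S)"
      using Lie_subgroup_graph[OF assms] unfolding Lie_algebra_def by blast
  qed
  show "Lie_algebra \<omega> (graph_group U S) \<subseteq> graph_algebra U S"
  proof
    fix \<xi> assume "\<xi> \<in> Lie_algebra \<omega> (graph_group U S)"
    then obtain M :: "('a affine_map, 'a affine_map) manifold" and \<gamma> :: "real \<Rightarrow> 'a affine_map" where "topspace (mtop M) = graph_group U S"
      and "smooth_map (vector_manifold :: (real, real) manifold) M \<gamma>" and \<xi>: "(\<gamma> has_vector_derivative \<xi>) (at 0)"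
      by (auto simp: Lie_algebra_def Lie_subgroup_def)
    then have \<gamma>: "\<gamma> t \<in> graph_group U S" for t
      using continuous_map_image_subset_topspace[of euclidean "mtop M" \<gamma>]
      by (auto simp: smooth_map_def vector_manifold_def)
    have D: "((\<lambda>t. l (\<gamma> t)) has_vector_derivative l \<xi>) (at 0)" if "bounded_linear l" for l :: "_ \<Rightarrow> 'c::real_normed_vector"
      using bounded_linear.has_vector_derivative[OF that \<xi>] .
    have eq: "l \<xi> = 0" if "bounded_linear l" "\<And>t. l (\<gamma> t) = a" for l :: "_ \<Rightarrow> 'c::real_normed_vector" and a
      using D[OF that(1)] that(2) vector_derivative_unique_at by (metis (no_types, lifting) has_vector_derivative_const ext)
    have "fst \<xi> - S (snd \<xi>) = 0"
    proof (rule eq[of _ id_blinfun])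
      show "bounded_linear (\<lambda>p. fst p - S (snd p))"
        by (intro bounded_linear_sub bounded_linear_fst bounded_linear_compose[OF bounded_linear_S] bounded_linear_snd)
      show "fst (\<gamma> t) - S (snd (\<gamma> t)) = id_blinfun" for t
        using \<gamma>[of t] by (auto simp: graph_group_def)
    qed
    \<comment> \<open>Membership in \<open>U\<close> is rewritten as a system of linear equations,
      by means of \<open>perp_perp\<close>.\<close>
    moreover have "\<omega> (snd \<xi>) u = 0" if "u \<in> perp U" for u
    proof (rule eq[of _ 0])
      show "bounded_linear (\<lambda>p :: 'a affine_map. \<omega> (snd p) u)"
        by (rule bounded_linear_compose[OF bounded_linear[OF linear_form_left] bounded_linear_snd])
      show "\<omega> (snd (\<gamma> t)) u = 0" for t
        using \<gamma>[of t] that antisymmetric[of u "snd (\<gamma> t)"] by (auto simp: graph_group_def perp_def)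
    qed
    then have "snd \<xi> \<in> U"
      using perp_perp[OF assms(1)] by (auto simp: perp_def)
    ultimately show "\<xi> \<in> graph_algebra U S"
      by (auto simp: graph_algebra_def intro!: image_eqI[of _ _ "snd \<xi>"] prod_eqI)
  qed
qed

lemma translation_subgroup_graph: "translation_subgroup (graph_group UNIV S) = graph_group {x. S x = 0} S"
  by (auto simp: translation_subgroup_def graph_group_def)

lemma subspace_kernel: "subspace {x. S x = 0}"
  by (simp add: subspace_def S_simps)

lemma dim_translation_subgroup:
  "dim (Lie_algebra \<omega> (translation_subgroup (graph_group UNIV S))) = dim {x. S x = 0}"
proof -
  have "Lie_algebra \<omega> (translation_subgroup (graph_group UNIV S)) = (\<lambda>x. (S x, x)) ` {x. S x = 0}"
    unfolding translation_subgroup_graph using subspace_kernel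
    by (subst Lie_algebra_graph) (auto simp: graph_algebra_def S_simps)
  then show ?thesis
    using fd1.dim_image_eq[OF bounded_linear.linear[OF bounded_linear_graph], of "{x. S x = 0}"]
    by (simp add: inj_on_def)
qed

text \<open>By total symmetry \<open>\<omega> x (S y z) = - \<omega> (S x y) z\<close>, so
  \<open>x\<close> is orthogonal to all values of \<open>S\<close> exactly if \<open>S x\<close>
  vanishes.\<close>

lemma kernel_eq_perp: "{x. S x = 0} = perp (support (\<lambda>x. S x))"
proof -
  have *: "\<omega> x (S y z) = - \<omega> (S x y) z" for x y z
    using S_form[of y x z] S_commute[of x y] by simp
  have "S x = 0 \<longleftrightarrow> (\<forall>u\<in>support (\<lambda>x. S x). \<omega> x u = 0)" for x
  proof
    assume "S x = 0"
    then have "\<omega> x u = 0" if "u \<in> {S y z | y z. True}" for u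
      using that by (auto simp: * form_simps)
    then show "\<forall>u\<in>support (\<lambda>x. S x). \<omega> x u = 0"
      unfolding support_def
      using linear_eq_on_span[OF linear_form_right, of "\<lambda>_. 0" "{S y z | y z. True}" x] by (auto simp: linear_zero)
  next
    assume u: "\<forall>u\<in>support (\<lambda>x. S x). \<omega> x u = 0"
    have "\<omega> x (S y z) = 0" for y z
      using u by (auto simp: support_def intro: span_base)
    then have "\<omega> (S x y) z = 0" for y z
      using * by simp
    then show "S x = 0"
      by (intro blinfun_eqI) (simp add: nondegenerate)
  qed
  then show ?thesis
    by (auto simp: perp_def)
qed

text \<open>Translates dimension \<open>2n - k\<close> of the translation subgroup into dimension
  \<open>k\<close> of the support.\<close>

lemma dim_kernel: "dim {x. S x = 0} + dim (support (\<lambda>x. S x)) = dim (UNIV :: 'a set)"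
  unfolding kernel_eq_perp by (rule dim_perp) (simp add: support_def)

text \<open>The support lies in the kernel of \<open>S\<close> by \<open>S_at_S\<close>, and this
  kernel is the complement of the support.\<close>

lemma isotropic_support: "isotropic \<omega> (support (\<lambda>x. S x))"
proof -
  have "support (\<lambda>x. S x) \<subseteq> {x. S x = 0}"
    unfolding support_def by (rule span_minimal[OF _ subspace_kernel]) auto
  then show ?thesis
    unfolding kernel_eq_perp by (auto simp: isotropic_def perp_def)
qed

lemma diffeomorphism_graph: "diffeomorphism (graph_manifold UNIV S) vector_manifold (\<lambda>h. aff_apply h 0)"
proof -
  have orbit: "(\<lambda>h :: 'a affine_map. aff_apply h 0) = snd"
    by auto
  have inj: "inj_on snd (graph_group UNIV S)"
    by (auto simp: graph_group_def inj_on_def)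
  have "snd ` graph_group UNIV S = UNIV"
    by (simp add: graph_group_def image_image)
  moreover have "inv_into (graph_group UNIV S) snd = (\<lambda>x. (id_blinfun + S x, x))"
    using inj by (intro ext inv_into_f_eq) (auto simp: graph_group_def)
  ultimately show ?thesis
    using inj smooth_map_from_graph[OF bounded_linear_snd, of UNIV] smooth_map_to_graph[OF bounded_linear_ident, of UNIV]
    unfolding diffeomorphism_def orbit by (simp add: bij_betw_def graph_manifold_def vector_manifold_def)
qed

lemma simply_transitive_graph: "simply_transitive_symplectic_type \<omega> (graph_group UNIV S)"
proof -
  have "connected (graph_group UNIV S)"
    unfolding graph_group_def
    by (intro connected_continuous_image continuous_intros linear_continuous_on bounded_linear_S convex_connected) simp
  then have "connected_space (mtop (graph_manifold UNIV S))"
    by (simp add: graph_manifold_def connected_space_subtopology)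
  then show ?thesis
    unfolding simply_transitive_symplectic_type_def
    using Lie_subgroup_graph[of UNIV] diffeomorphism_graph by auto
qed

lemma comm_group_graph: "comm_group ((AffSp \<omega>)\<lparr>carrier := graph_group UNIV S\<rparr>)"
proof (rule group.group_comm_groupI)
  show "group ((AffSp \<omega>)\<lparr>carrier := graph_group UNIV S\<rparr>)"
    using subgroup_graph[of UNIV] by (simp add: subgroup.subgroup_is_group group_AffSp)
  fix g h assume "g \<in> carrier ((AffSp \<omega>)\<lparr>carrier := graph_group UNIV S\<rparr>)"
    and "h \<in> carrier ((AffSp \<omega>)\<lparr>carrier := graph_group UNIV S\<rparr>)"
  then obtain x y where "g = (id_blinfun + S x, x)" "h = (id_blinfun + S y, y)"
    by (auto simp: graph_group_def)
  then show "g \<otimes>\<^bsub>(AffSp \<omega>)\<lparr>carrier := graph_group UNIV S\<rparr>\<^esub> h = h \<otimes>\<^bsub>(AffSp \<omega>)\<lparr>carrier := graph_group UNIV S\<rparr>\<^esub> g"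
    by (simp add: graph_mult add.commute[of y x] S_commute[of y x] del: AffSp_simps(3))
qed

lemma Abelian_groups_graph: "graph_group UNIV S \<in> Abelian_groups \<omega> d \<longleftrightarrow> d = dim {x. S x = 0}"
  using simply_transitive_graph comm_group_graph dim_translation_subgroup by (auto simp: Abelian_groups_def)

lemma S_of_graph: "S_of \<omega> (graph_group UNIV S) = (\<lambda>x. S x)"
proof -
  have "inv_into (graph_algebra UNIV S) snd x = (S x, x)" for x
    by (rule inv_into_f_eq) (auto simp: graph_algebra_def inj_on_def)
  then show ?thesis
    by (simp add: S_of_def Lie_algebra_graph fun_eq_iff)
qed

end

section \<open>Abelian simply transitive groups as graphs, and their conjugacy\<close>

context symplectic_space begin

lemma Abelian_group_is_graph:
  assumes "H \<in> Abelian_groups \<omega> d"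
  obtains S where "nilpotent_symbol \<omega> S" and "H = graph_group UNIV S"
proof -
  interpret H: comm_group "(AffSp \<omega>)\<lparr>carrier := H\<rparr>"
    using assms by (simp add: Abelian_groups_def)
  have sub: "subgroup H (AffSp \<omega>)"
    using assms by (auto simp: Abelian_groups_def simply_transitive_symplectic_type_def Lie_subgroup_def)
  have bij: "bij_betw (\<lambda>h. aff_apply h 0) H UNIV"
    using assms by (auto simp: Abelian_groups_def simply_transitive_symplectic_type_def Lie_subgroup_def
        diffeomorphism_def vector_manifold_def)
  \<comment> \<open>The linear part of the unique element of \<open>H\<close> that moves
    \<open>0\<close> to \<open>x\<close>.\<close>
  define A where "A x = fst (inv_into H (\<lambda>h. aff_apply h 0) x)" for x
  have A_H: "(A x, x) \<in> H" for x
  proof -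
    have "inv_into H (\<lambda>h. aff_apply h 0) x = (A x, x)"
      using bij_betw_inv_into_right[OF bij, of x] by (cases "inv_into H (\<lambda>h. aff_apply h 0) x") (simp add: A_def)
    then show ?thesis
      using bij_betw_apply[OF bij_betw_inv_into[OF bij], of x] by simp
  qed
  have A_eq: "B = A x" if "(B, x) \<in> H" for B x
    using inj_onD[OF bij_betw_imp_inj_on[OF bij] _ that A_H[of x]] by simp
  define S where "S x = A x - id_blinfun" for x
  have A: "A x = id_blinfun + S x" for x
    by (simp add: S_def)
  have H: "H = graph_group UNIV S"
    using A_H A_eq by (auto simp: graph_group_def A)
  \<comment> \<open>Compare the translation parts of the two products.\<close>
  have comm: "S x y = S y x" for x y
    using H.m_comm[of "(A x, x)" "(A y, y)"] A_H by (simp add: A blinfun.add_left)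
  \<comment> \<open>Each \<open>S x\<close> is linear in its argument; symmetry carries this over to
    the index \<open>x\<close>.\<close>
  have linear: "linear S"
    by (rule linearI; rule blinfun_eqI)
      (metis comm blinfun.add_left blinfun.add_right, metis comm blinfun.scaleR_left blinfun.scaleR_right)
  note S_simps = linear_add[OF linear] linear_cmul[OF linear]
  \<comment> \<open>The product of the elements over \<open>x\<close> and \<open>y\<close> lies over
    \<open>A x y + x\<close>, so its linear part must be the one that \<open>H\<close> has
    there.\<close>
  have assoc: "S x (S y z) = S (S x y) z" for x y z
  proof -
    have "(A x, x) \<otimes>\<^bsub>AffSp \<omega>\<^esub> (A y, y) \<in> H"
      using subgroup.m_closed[OF sub A_H A_H] .
    then have "A x (A y z) = A (A x y + x) z"
      using A_eq by (metis AffSp_simps(3) blinfun_apply_blinfun_compose)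
    then show ?thesis
      by (simp add: A S_simps blinfun.add_left blinfun.add_right)
  qed
  have Sp: "\<omega> (S x y) z + \<omega> y (S x z) + \<omega> (S x y) (S x z) = 0" for x y z
  proof -
    have "A x \<in> Sp \<omega>"
      using subgroup.mem_carrier[OF sub A_H] by simp
    then have "\<omega> (A x y) (A x z) = \<omega> y z"
      by (simp add: Sp_def)
    then show ?thesis
      by (simp add: A blinfun.add_left form_simps)
  qed
  \<comment> \<open>The two summands of the condition have degrees one and two in \<open>x\<close>, so each of them vanishes.\<close>
  have form: "\<omega> (S x y) z + \<omega> y (S x z) = 0" and square: "\<omega> (S x y) (S x z) = 0" for x y z
    using Sp[of x y z] Sp[of "2 *\<^sub>R x" y z] by (simp_all add: S_simps blinfun.scaleR_left form_simps)
  \<comment> \<open>\<open>form\<close> moves the outer operator to the other side, where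
    \<open>square\<close> applies.\<close>
  have nil: "S x (S x y) = 0" for x y
    using form[of x "S x y"] square[of x y] by (intro nondegenerate) simp
  have "S x (S y z) = 0" for x y z
  proof -
    have "S x (S y z) + S y (S x z) = 0"
      using nil[of "x + y" z] by (simp add: S_simps blinfun.add_left blinfun.add_right nil add.commute)
    moreover have "S x (S y z) = S y (S x z)"
      by (simp add: assoc comm[of x y])
    ultimately have "2 *\<^sub>R S x (S y z) = 0"
      by (simp add: scaleR_2)
    then show ?thesis by simp
  qed
  then have "nilpotent_symbol \<omega> S"
    unfolding nilpotent_symbol_def using linear comm form by blast
  with H that show thesis by blast
qed

text \<open>The translation part \<open>a\<close> of \<open>g\<close> only shifts the parameter of
  the conjugated element by a value of \<open>S'\<close>, on which \<open>S'\<close> vanishes. Hence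
  conjugacy becomes equivalence under linear symplectic maps.\<close>

lemma conj_graph:
  assumes "nilpotent_symbol \<omega> S" and "nilpotent_symbol \<omega> S'"
  shows "(\<exists>g\<in>carrier (AffSp \<omega>). graph_group UNIV S' =
      (\<lambda>h. g \<otimes>\<^bsub>AffSp \<omega>\<^esub> h \<otimes>\<^bsub>AffSp \<omega>\<^esub> inv\<^bsub>AffSp \<omega>\<^esub> g) ` graph_group UNIV S) \<longleftrightarrow>
    (\<exists>A\<in>Sp \<omega>. \<forall>x y. S' (A x) (A y) = A (S x y))"
proof -
  interpret S: nilpotent \<omega> E S by unfold_locales (rule assms)
  interpret S': nilpotent \<omega> E S' by unfold_locales (rule assms)
  interpret G: group "AffSp \<omega>" by (rule group_AffSp)
  have "\<exists>A\<in>Sp \<omega>. \<forall>x y. S' (A x) (A y) = A (S x y)"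
    if g: "g \<in> carrier (AffSp \<omega>)" and eq: "graph_group UNIV S' =
      (\<lambda>h. g \<otimes>\<^bsub>AffSp \<omega>\<^esub> h \<otimes>\<^bsub>AffSp \<omega>\<^esub> inv\<^bsub>AffSp \<omega>\<^esub> g) ` graph_group UNIV S" for g
  proof -
    obtain A a where A: "g = (A, a)" "A \<in> Sp \<omega>"
      using g by auto
    have "S' (A x) (A y) = A (S x y)" for x y
    proof -
      let ?h = "(id_blinfun + S x, x)"
      have "g \<otimes>\<^bsub>AffSp \<omega>\<^esub> ?h \<otimes>\<^bsub>AffSp \<omega>\<^esub> inv\<^bsub>AffSp \<omega>\<^esub> g \<in> graph_group UNIV S'"
        unfolding eq by (rule imageI) (simp add: graph_group_def)
      then obtain z where "g \<otimes>\<^bsub>AffSp \<omega>\<^esub> ?h \<otimes>\<^bsub>AffSp \<omega>\<^esub> inv\<^bsub>AffSp \<omega>\<^esub> g = (id_blinfun + S' z, z)"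
        by (auto simp: graph_group_def)
      moreover have "?h \<in> carrier (AffSp \<omega>)" "(id_blinfun + S' z, z) \<in> carrier (AffSp \<omega>)"
        using S.graph_Sp S'.graph_Sp by simp_all
      \<comment> \<open>Clearing the inverse leaves two products whose components can be compared
        directly.\<close>
      ultimately have "g \<otimes>\<^bsub>AffSp \<omega>\<^esub> ?h = (id_blinfun + S' z, z) \<otimes>\<^bsub>AffSp \<omega>\<^esub> g"
        using g by (intro G.inv_solve_right'[THEN iffD1] G.m_closed)
      then have *: "(id_blinfun + S' z) o\<^sub>L A = A o\<^sub>L (id_blinfun + S x)" and z: "a + S' z a + z = A x + a"
        by (simp_all add: A(1) blinfun.add_left)
      have "S' z (A y) = A (S x y)"
        using arg_cong[OF *, of "\<lambda>B. B y"] by (simp add: blinfun.add_left blinfun.add_right)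
      moreover have "A x = S' z a + z"
        using z by (simp add: algebra_simps)
      ultimately show ?thesis
        by (simp add: S'.S_simps)
    qed
    with A(2) show ?thesis by blast
  qed
  moreover have "\<exists>g\<in>carrier (AffSp \<omega>). graph_group UNIV S' =
      (\<lambda>h. g \<otimes>\<^bsub>AffSp \<omega>\<^esub> h \<otimes>\<^bsub>AffSp \<omega>\<^esub> inv\<^bsub>AffSp \<omega>\<^esub> g) ` graph_group UNIV S"
    if A: "A \<in> Sp \<omega>" and eq: "\<And>x y. S' (A x) (A y) = A (S x y)" for A
  proof (intro bexI)
    let ?g = "(A, 0)"
    show g: "?g \<in> carrier (AffSp \<omega>)"
      using A by simp
    have "?g \<otimes>\<^bsub>AffSp \<omega>\<^esub> (id_blinfun + S x, x) = (id_blinfun + S' (A x), A x) \<otimes>\<^bsub>AffSp \<omega>\<^esub> ?g" for x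
      by (auto simp: blinfun.add_left blinfun.add_right eq intro!: blinfun_eqI)
    moreover have "(id_blinfun + S x, x) \<in> carrier (AffSp \<omega>)" "(id_blinfun + S' (A x), A x) \<in> carrier (AffSp \<omega>)" for x
      using S.graph_Sp S'.graph_Sp by simp_all
    ultimately have "?g \<otimes>\<^bsub>AffSp \<omega>\<^esub> (id_blinfun + S x, x) \<otimes>\<^bsub>AffSp \<omega>\<^esub> inv\<^bsub>AffSp \<omega>\<^esub> ?g = (id_blinfun + S' (A x), A x)" for x
      using g by (intro G.inv_solve_right'[THEN iffD2] G.m_closed)
    then have "(\<lambda>h. ?g \<otimes>\<^bsub>AffSp \<omega>\<^esub> h \<otimes>\<^bsub>AffSp \<omega>\<^esub> inv\<^bsub>AffSp \<omega>\<^esub> ?g) ` graph_group UNIV S = (\<lambda>x. (id_blinfun + S' x, x)) ` range A"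
      by (simp add: graph_group_def image_image del: AffSp_simps)
    moreover have "range A = UNIV"
      using surj_Sp[OF A] by simp
    ultimately show "graph_group UNIV S' =
      (\<lambda>h. ?g \<otimes>\<^bsub>AffSp \<omega>\<^esub> h \<otimes>\<^bsub>AffSp \<omega>\<^esub> inv\<^bsub>AffSp \<omega>\<^esub> ?g) ` graph_group UNIV S"
      by (simp add: graph_group_def)
  qed
  ultimately show ?thesis by blast
qed

end

section \<open>Cubic tensors\<close>

lemma act_act: "act g (act h T) = act (g o\<^sub>L h) T"
proof -
  have "\<alpha> o\<^sub>L g o\<^sub>L h = \<alpha> o\<^sub>L (g o\<^sub>L h)" for \<alpha> :: "'a \<Rightarrow>\<^sub>L real"
    by (rule blinfun_eqI) simp
  then show ?thesis
    by (simp add: act_def)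
qed

lemma act_id: "act id_blinfun T = T"
proof -
  have "\<alpha> o\<^sub>L id_blinfun = \<alpha>" for \<alpha> :: "'a \<Rightarrow>\<^sub>L real"
    by (rule blinfun_eqI) simp
  then show ?thesis
    by (simp add: act_def)
qed

text \<open>Functionals that agree on all of \<open>V\<close> are equal, which settles the
  restriction clause; symmetry spreads linearity from the first slot to the others.\<close>

lemma S3_UNIV_iff:
  "T \<in> S3 UNIV \<longleftrightarrow> (\<forall>\<beta> \<gamma>. linear (\<lambda>\<alpha>. T \<alpha> \<beta> \<gamma>)) \<and>
    (\<forall>\<alpha> \<beta> \<gamma>. T \<alpha> \<beta> \<gamma> = T \<beta> \<alpha> \<gamma> \<and> T \<alpha> \<beta> \<gamma> = T \<alpha> \<gamma> \<beta>)" (is "?l \<longleftrightarrow> ?r")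
proof
  assume r: ?r
  note lin = r[THEN conjunct1, rule_format]
  note sym = r[THEN conjunct2, rule_format, THEN conjunct1] r[THEN conjunct2, rule_format, THEN conjunct2]
  have 2: "linear (\<lambda>\<beta>. T \<alpha> \<beta> \<gamma>)" for \<alpha> \<gamma>
    by (rule back_subst[of linear, OF lin[of \<alpha> \<gamma>]]) (rule ext, rule sym(1))
  have 3: "linear (\<lambda>\<gamma>. T \<alpha> \<beta> \<gamma>)" for \<alpha> \<beta>
    by (rule back_subst[of linear, OF 2[of \<alpha> \<beta>]]) (rule ext, rule sym(2))
  have cong: "T \<alpha> \<beta> \<gamma> = T \<alpha>' \<beta>' \<gamma>'"
    if "\<forall>w\<in>UNIV. blinfun_apply \<alpha> w = blinfun_apply \<alpha>' w \<and> blinfun_apply \<beta> w = blinfun_apply \<beta>' w \<and>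
      blinfun_apply \<gamma> w = blinfun_apply \<gamma>' w" for \<alpha> \<alpha>' \<beta> \<beta>' \<gamma> \<gamma>'
  proof -
    have "\<alpha> = \<alpha>'" "\<beta> = \<beta>'" "\<gamma> = \<gamma>'"
      using that by (auto intro: blinfun_eqI)
    then show ?thesis by simp
  qed
  show ?l
    unfolding S3_def mem_Collect_eq by (intro conjI allI impI lin 2 3 sym) (rule cong)
next
  assume ?l
  then show ?r
    unfolding S3_def mem_Collect_eq by (elim conjE) (intro conjI; assumption)
qed

lemma S3_symmetric:
  assumes "T \<in> S3 UNIV"
  shows "T \<alpha> \<beta> \<gamma> = T \<beta> \<alpha> \<gamma>" and "T \<alpha> \<beta> \<gamma> = T \<alpha> \<gamma> \<beta>"
proof -
  note * = assms[unfolded S3_UNIV_iff, THEN conjunct2, rule_format]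
  show "T \<alpha> \<beta> \<gamma> = T \<beta> \<alpha> \<gamma>"
    by (rule *[THEN conjunct1])
  show "T \<alpha> \<beta> \<gamma> = T \<alpha> \<gamma> \<beta>"
    by (rule *[THEN conjunct2])
qed

lemma S3_UNIV_I:
  assumes "\<And>\<beta> \<gamma>. linear (\<lambda>\<alpha>. T \<alpha> \<beta> \<gamma>)" and "\<And>\<alpha> \<beta> \<gamma>. T \<alpha> \<beta> \<gamma> = T \<beta> \<alpha> \<gamma>"
    and "\<And>\<alpha> \<beta> \<gamma>. T \<alpha> \<beta> \<gamma> = T \<alpha> \<gamma> \<beta>"
  shows "T \<in> S3 UNIV"
  unfolding S3_UNIV_iff by (intro conjI allI assms)

lemma S3_subset: "S3 W \<subseteq> S3 UNIV"
proof
  fix T assume "T \<in> S3 W"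
  then show "T \<in> S3 UNIV"
    unfolding S3_UNIV_iff unfolding S3_def mem_Collect_eq by (elim conjE) (intro conjI; assumption)
qed

lemma S3_iff:
  "T \<in> S3 W \<longleftrightarrow> T \<in> S3 UNIV \<and>
    (\<forall>\<alpha> \<alpha>' \<beta> \<beta>' \<gamma> \<gamma>'.
        (\<forall>w\<in>W. blinfun_apply \<alpha> w = blinfun_apply \<alpha>' w \<and> blinfun_apply \<beta> w = blinfun_apply \<beta>' w \<and>
           blinfun_apply \<gamma> w = blinfun_apply \<gamma>' w) \<longrightarrow> T \<alpha> \<beta> \<gamma> = T \<alpha>' \<beta>' \<gamma>')" (is "_ \<longleftrightarrow> _ \<and> ?P")
proof (intro iffI conjI)
  assume T: "T \<in> S3 W"
  show "T \<in> S3 UNIV"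
    using T S3_subset by (rule subsetD[rotated])
  show ?P
    using T unfolding S3_def mem_Collect_eq by (elim conjE) assumption
next
  assume "T \<in> S3 UNIV \<and> ?P"
  then show "T \<in> S3 W"
    unfolding S3_def mem_Collect_eq by (elim conjE) (intro conjI; assumption)
qed

lemma S3_cong:
  assumes "T \<in> S3 W"
    and "\<And>w. w \<in> W \<Longrightarrow> blinfun_apply \<alpha> w = blinfun_apply \<alpha>' w \<and> blinfun_apply \<beta> w = blinfun_apply \<beta>' w \<and>
      blinfun_apply \<gamma> w = blinfun_apply \<gamma>' w"
  shows "T \<alpha> \<beta> \<gamma> = T \<alpha>' \<beta>' \<gamma>'"
  by (rule S3_iff[THEN iffD1, OF assms(1), THEN conjunct2, rule_format]) (rule assms(2))

lemma act_S3:
  assumes "T \<in> S3 UNIV"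
  shows "act g T \<in> S3 UNIV"
proof -
  have lin: "linear (\<lambda>\<alpha>. \<alpha> o\<^sub>L g)"
    by (intro bounded_linear.linear bounded_bilinear.bounded_linear_left[OF bounded_bilinear_blinfun_compose])
  have "linear (\<lambda>\<alpha>. T \<alpha> \<beta> \<gamma>)" for \<beta> \<gamma>
    by (rule assms[unfolded S3_UNIV_iff, THEN conjunct1, rule_format])
  from linear_compose[OF lin this] have "linear (\<lambda>\<alpha>. act g T \<alpha> \<beta> \<gamma>)" for \<beta> \<gamma>
    by (simp add: act_def o_def)
  moreover have "act g T \<alpha> \<beta> \<gamma> = act g T \<beta> \<alpha> \<gamma>" "act g T \<alpha> \<beta> \<gamma> = act g T \<alpha> \<gamma> \<beta>" for \<alpha> \<beta> \<gamma>
    unfolding act_def by (rule S3_symmetric[OF assms])+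
  ultimately show ?thesis
    by (rule S3_UNIV_I)
qed

text \<open>Justifies representing an element of GL(W) by any extension to \<open>V\<close>, in
  particular by a symplectic one.\<close>

lemma act_cong_on:
  assumes "T \<in> S3 W" and "\<And>w. w \<in> W \<Longrightarrow> blinfun_apply g w = blinfun_apply h w"
  shows "act g T = act h T"
  unfolding act_def by (intro ext S3_cong[OF assms(1)]) (simp add: assms(2))

section \<open>Duality, and the passage between tensors and operators\<close>

context symplectic_space begin

text \<open>The vector stands in the second slot, as in \<open>lower\<close>. This is minus the
  functional \<open>\<omega> X _\<close>, whence the sign in the surjectivity part of
  \<open>bij_flat\<close>.\<close>

definition flat :: "'a \<Rightarrow> 'a \<Rightarrow>\<^sub>L real" where
  "flat X = Blinfun (\<lambda>v. \<omega> v X)"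

lemma flat_apply [simp]: "flat X v = \<omega> v X"
  by (simp add: flat_def bounded_linear linear_form_left bounded_linear_Blinfun_apply)

lemma lower_flat: "lower \<omega> T X Y Z = T (flat X) (flat Y) (flat Z)"
  by (simp add: lower_def flat_def)

lemma linear_flat: "linear flat"
  by (rule linearI) (auto intro!: blinfun_eqI simp: form_simps blinfun.add_left blinfun.scaleR_left)

lemma bij_flat: "bij flat"
proof (rule bijI)
  show "inj flat"
  proof (rule injI, rule form_eqI)
    fix X Y z assume "flat X = flat Y"
    then have "\<omega> z X = \<omega> z Y"
      by (metis flat_apply)
    then show "\<omega> X z = \<omega> Y z"
      by (simp add: antisymmetric[of z])
  qed
  have "\<exists>X. \<alpha> = flat X" for \<alpha>
  proof -
    have "linear (\<lambda>v. - \<alpha> v)"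
      by (intro bounded_linear.linear bounded_linear_minus blinfun.bounded_linear_right)
    then obtain X where "\<And>v. \<omega> X v = - \<alpha> v"
      using representable by blast
    then have "\<alpha> = flat X"
      by (intro blinfun_eqI) (simp add: antisymmetric[of X])
    then show ?thesis ..
  qed
  then show "surj flat"
    by (auto simp: surj_def)
qed

lemma cubic_eqI:
  assumes "\<And>X Y Z. lower \<omega> T X Y Z = lower \<omega> T' X Y Z"
  shows "T = T'"
proof (intro ext)
  fix \<alpha> \<beta> \<gamma>
  obtain X Y Z where "\<alpha> = flat X" "\<beta> = flat Y" "\<gamma> = flat Z"
    using bij_flat by (metis bij_pointE)
  then show "T \<alpha> \<beta> \<gamma> = T' \<alpha> \<beta> \<gamma>"
    using assms by (simp add: lower_flat)
qed

lemma operator_of_eqI: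
  assumes "\<And>X Y Z. \<omega> (S X Y) Z = lower \<omega> T X Y Z"
  shows "operator_of \<omega> T = S"
  unfolding operator_of_def
proof (rule the_equality)
  fix S' assume "\<forall>X Y Z. \<omega> (S' X Y) Z = lower \<omega> T X Y Z"
  then show "S' = S"
    using assms by (intro ext form_eqI) simp
qed (use assms in blast)

lemma tensor_of_eqI:
  assumes "T \<in> S3 UNIV" and "\<And>X Y Z. \<omega> (S X Y) Z = lower \<omega> T X Y Z"
  shows "tensor_of \<omega> S = T"
  unfolding tensor_of_def
proof (rule the_equality)
  fix T' assume "T' \<in> S3 UNIV \<and> (\<forall>X Y Z. \<omega> (S X Y) Z = lower \<omega> T' X Y Z)"
  then show "T' = T"
    using assms(2) by (intro cubic_eqI) metis
qed (use assms in blast)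

text \<open>Existence behind the definite description in \<open>operator_of\<close>: for fixed
  \<open>X\<close> and \<open>Y\<close> the cubic is linear in \<open>Z\<close>, hence represented
  by a vector.\<close>

lemma form_operator_of:
  assumes "T \<in> S3 UNIV"
  shows "\<omega> (operator_of \<omega> T X Y) Z = lower \<omega> T X Y Z"
proof -
  have "linear (T \<alpha> \<beta>)" for \<alpha> \<beta>
    using assms by (simp add: S3_def)
  then have "linear (\<lambda>Z. lower \<omega> T X Y Z)" for X Y
    using linear_compose[OF linear_flat, of "T (flat X) (flat Y)"] by (simp add: lower_flat o_def)
  then have "\<exists>v. \<forall>Z. \<omega> v Z = lower \<omega> T X Y Z" for X Y
    using representable by metis
  then obtain S where "\<And>X Y Z. \<omega> (S X Y) Z = lower \<omega> T X Y Z"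
    by metis
  with operator_of_eqI show ?thesis by metis
qed

lemma tensor_of_operator_of: "T \<in> S3 UNIV \<Longrightarrow> tensor_of \<omega> (operator_of \<omega> T) = T"
  by (rule tensor_of_eqI) (simp_all add: form_operator_of)

lemma lower_act:
  assumes "g \<in> Sp \<omega>"
  shows "lower \<omega> (act g T) (g X) (g Y) (g Z) = lower \<omega> T X Y Z"
proof -
  have "flat (g X) o\<^sub>L g = flat X" for X
    using assms by (intro blinfun_eqI) (simp add: Sp_def)
  then show ?thesis
    by (simp add: lower_flat act_def)
qed

lemma operator_of_act:
  assumes "T \<in> S3 UNIV" and "g \<in> Sp \<omega>"
  shows "operator_of \<omega> (act g T) (g X) (g Y) = g (operator_of \<omega> T X Y)"
proof (rule form_eqI)
  fix z
  obtain Z where "z = g Z"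
    using surj_Sp[OF assms(2)] by (metis surjD)
  moreover have "\<omega> (g (operator_of \<omega> T X Y)) (g Z) = \<omega> (operator_of \<omega> T X Y) Z"
    using assms(2) by (simp add: Sp_def)
  ultimately show "\<omega> (operator_of \<omega> (act g T) (g X) (g Y)) z = \<omega> (g (operator_of \<omega> T X Y)) z"
    using assms by (simp add: form_operator_of act_S3 lower_act)
qed

text \<open>The right-hand side is the condition found in \<open>conj_graph\<close>; this links
  conjugacy of groups to Sp(V)-orbits of tensors.\<close>

lemma act_eq_iff:
  assumes "T \<in> S3 UNIV" and "T' \<in> S3 UNIV" and "g \<in> Sp \<omega>"
  shows "T' = act g T \<longleftrightarrow> (\<forall>X Y. operator_of \<omega> T' (g X) (g Y) = g (operator_of \<omega> T X Y))"
proof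
  assume *: "\<forall>X Y. operator_of \<omega> T' (g X) (g Y) = g (operator_of \<omega> T X Y)"
  have "operator_of \<omega> T' = operator_of \<omega> (act g T)"
  proof (intro ext)
    fix x y
    obtain X Y where "x = g X" "y = g Y"
      using surj_Sp[OF assms(3)] by (metis surjD)
    then show "operator_of \<omega> T' x y = operator_of \<omega> (act g T) x y"
      using * operator_of_act[OF assms(1,3)] by simp
  qed
  then show "T' = act g T"
    using tensor_of_operator_of assms act_S3 by metis
qed (use operator_of_act assms in blast)

lemma support_act:
  assumes "T \<in> S3 UNIV" and "g \<in> Sp \<omega>"
  shows "support (operator_of \<omega> (act g T)) = g ` support (operator_of \<omega> T)"
proof -
  have lin: "linear g"
    by (simp add: blinfun.bounded_linear_right bounded_linear.linear)
  have "{operator_of \<omega> (act g T) x y | x y. True} = g ` {operator_of \<omega> T X Y | X Y. True}" (is "?L = ?R")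
  proof
    show "?R \<subseteq> ?L"
      using operator_of_act[OF assms, symmetric] by auto
    show "?L \<subseteq> ?R"
    proof
      fix z assume "z \<in> ?L"
      then obtain x y where z: "z = operator_of \<omega> (act g T) x y" by blast
      obtain X Y where "x = g X" "y = g Y"
        using surj_Sp[OF assms(2)] by (metis surjD)
      then show "z \<in> ?R"
        using operator_of_act[OF assms] z by auto
    qed
  qed
  then show ?thesis
    by (simp add: support_def span_linear_image[OF lin])
qed

lemma operator_of_symmetric:
  assumes "T \<in> S3 UNIV"
  shows "operator_of \<omega> T X Y = operator_of \<omega> T Y X"
    and "\<omega> (operator_of \<omega> T X Y) Z = \<omega> (operator_of \<omega> T X Z) Y"
proof -
  note sym = S3_symmetric[OF assms]
  show "operator_of \<omega> T X Y = operator_of \<omega> T Y X"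
    by (intro form_eqI) (unfold form_operator_of[OF assms] lower_flat, rule sym(1))
  show "\<omega> (operator_of \<omega> T X Y) Z = \<omega> (operator_of \<omega> T X Z) Y"
    unfolding form_operator_of[OF assms] lower_flat by (rule sym(2))
qed

text \<open>In its last slot a tensor evaluates the functional at a value of
  \<open>operator_of\<close>, that is, at a vector of the support. Symmetry brings every argument
  into that slot.\<close>

lemma S3_I:
  assumes T: "T \<in> S3 UNIV" and W: "support (operator_of \<omega> T) \<subseteq> W"
  shows "T \<in> S3 W"
proof -
  note sym = S3_symmetric[OF T]
  have *: "T \<beta> \<gamma> \<alpha> = T \<beta> \<gamma> \<alpha>'" if eq: "\<forall>w\<in>W. blinfun_apply \<alpha> w = blinfun_apply \<alpha>' w" for \<alpha> \<alpha>' \<beta> \<gamma>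
  proof -
    obtain X X' Y Z where XYZ: "\<alpha> = flat X" "\<alpha>' = flat X'" "\<beta> = flat Y" "\<gamma> = flat Z"
      using bij_flat by (metis bij_pointE)
    have "operator_of \<omega> T Y Z \<in> W"
      using W by (auto simp: support_def intro: span_base)
    then have "\<omega> (operator_of \<omega> T Y Z) X = \<omega> (operator_of \<omega> T Y Z) X'"
      using eq by (simp add: XYZ)
    then show ?thesis
      by (simp add: form_operator_of[OF T] lower_flat XYZ)
  qed
  have cong: "T \<alpha> \<beta> \<gamma> = T \<alpha>' \<beta>' \<gamma>'"
    if "\<forall>w\<in>W. blinfun_apply \<alpha> w = blinfun_apply \<alpha>' w \<and> blinfun_apply \<beta> w = blinfun_apply \<beta>' w \<and>
           blinfun_apply \<gamma> w = blinfun_apply \<gamma>' w" for \<alpha> \<alpha>' \<beta> \<beta>' \<gamma> \<gamma>'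
  proof -
    have "T \<alpha> \<beta> \<gamma> = T \<alpha> \<beta> \<gamma>'"
      using that by (intro *) simp
    also have "\<dots> = T \<alpha> \<gamma>' \<beta>"
      by (rule sym(2))
    also have "\<dots> = T \<alpha> \<gamma>' \<beta>'"
      using that by (intro *) simp
    also have "\<dots> = T \<gamma>' \<beta>' \<alpha>"
      using sym(1)[of \<alpha> \<gamma>' \<beta>'] sym(2)[of \<gamma>' \<alpha> \<beta>'] by simp
    also have "\<dots> = T \<gamma>' \<beta>' \<alpha>'"
      using that by (intro *) simp
    also have "\<dots> = T \<alpha>' \<beta>' \<gamma>'"
      using sym(2)[of \<gamma>' \<beta>' \<alpha>'] sym(1)[of \<gamma>' \<alpha>' \<beta>'] sym(2)[of \<alpha>' \<gamma>' \<beta>'] by simp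
    finally show ?thesis .
  qed
  show ?thesis
    by (intro S3_iff[THEN iffD2, OF conjI, OF T] allI impI) (rule cong)
qed

lemma nilpotent_symbol_operator_of:
  assumes T: "T \<in> S3 UNIV" and iso: "isotropic \<omega> (support (operator_of \<omega> T))"
  obtains S where "nilpotent_symbol \<omega> S" and "(\<lambda>x. blinfun_apply (S x)) = operator_of \<omega> T"
proof -
  let ?O = "operator_of \<omega> T"
  note sym = operator_of_symmetric[OF T]
  have lin: "linear (?O X)" for X
  proof (rule linearI; rule form_eqI)
    show "\<omega> (?O X (Y + Z)) z = \<omega> (?O X Y + ?O X Z) z" for Y Z z
      using sym(2)[of X _ z] by (simp add: form_simps)
    show "\<omega> (?O X (c *\<^sub>R Y)) z = \<omega> (c *\<^sub>R ?O X Y) z" for c Y z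
      using sym(2)[of X _ z] by (simp add: form_simps)
  qed
  define S where "S X = Blinfun (?O X)" for X
  have S: "blinfun_apply (S X) = ?O X" for X
    by (simp add: S_def bounded_linear[OF lin] bounded_linear_Blinfun_apply)
  have linear_S: "linear S"
  proof (rule linearI; rule blinfun_eqI)
    show "S (X + Y) Z = (S X + S Y) Z" for X Y Z
      using linear_add[OF lin] sym(1)[of _ Z] by (simp add: S blinfun.add_left)
    show "S (c *\<^sub>R X) Z = (c *\<^sub>R S X) Z" for c X Z
      using linear_cmul[OF lin] sym(1)[of _ Z] by (simp add: S blinfun.scaleR_left)
  qed
  have form: "\<omega> (S x y) z + \<omega> y (S x z) = 0" for x y z
    using sym(2)[of x y z] antisymmetric[of "?O x z" y] by (simp add: S)
  have commute: "S x y = S y x" for x y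
    unfolding S by (rule sym(1))
  \<comment> \<open>Skewness turns the pairing with \<open>w\<close> into a pairing of two vectors
    of the support.\<close>
  have nilpotent: "S x (S y z) = 0" for x y z
  proof (rule nondegenerate)
    fix w
    have "\<omega> (?O y z) (?O x w) = 0"
      using iso by (auto simp: isotropic_def support_def intro!: span_base)
    then show "\<omega> (S x (S y z)) w = 0"
      using form[of x "S y z" w] by (simp add: S)
  qed
  have "nilpotent_symbol \<omega> S"
    unfolding nilpotent_symbol_def by (intro conjI allI linear_S commute form nilpotent)
  moreover have "(\<lambda>x. blinfun_apply (S x)) = ?O"
    by (simp add: S fun_eq_iff)
  ultimately show thesis by (rule that)
qed

text \<open>Existence behind \<open>tensor_of\<close>: the trilinear form of \<open>S\<close> is
  carried over to functionals by the inverse of \<open>flat\<close>.\<close>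

lemma tensor_of_nilpotent_symbol:
  assumes "nilpotent_symbol \<omega> S"
  defines "T \<equiv> tensor_of \<omega> (\<lambda>x. blinfun_apply (S x))"
  shows "T \<in> S3 UNIV" and "operator_of \<omega> T = (\<lambda>x. blinfun_apply (S x))"
proof -
  interpret nilpotent \<omega> E S by unfold_locales (rule assms)
  define sharp where "sharp = inv_into UNIV flat"
  have flat_sharp: "flat (sharp \<alpha>) = \<alpha>" and sharp_flat: "sharp (flat x) = x" for \<alpha> x
    using bij_flat by (simp_all add: sharp_def bij_def surj_f_inv_f)
  have "linear sharp"
  proof (rule linearI)
    show "sharp (\<alpha> + \<beta>) = sharp \<alpha> + sharp \<beta>" for \<alpha> \<beta>
      using sharp_flat[of "sharp \<alpha> + sharp \<beta>"] by (simp add: linear_add[OF linear_flat] flat_sharp)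
    show "sharp (c *\<^sub>R \<alpha>) = c *\<^sub>R sharp \<alpha>" for c \<alpha>
      using sharp_flat[of "c *\<^sub>R sharp \<alpha>"] by (simp add: linear_cmul[OF linear_flat] flat_sharp)
  qed
  note sharp_simps = linear_add[OF this] linear_cmul[OF this]
  define C where "C x y z = \<omega> (S x y) z" for x y z
  have C: "C x y z = C y x z" "C x y z = C x z y" for x y z
    using S_commute[of x y] S_form[of x y z] antisymmetric[of "S x z" y] by (simp_all add: C_def)
  define T' where "T' \<alpha> \<beta> \<gamma> = C (sharp \<alpha>) (sharp \<beta>) (sharp \<gamma>)" for \<alpha> \<beta> \<gamma>
  have "linear (\<lambda>\<alpha>. T' \<alpha> \<beta> \<gamma>)" for \<beta> \<gamma>
    by (rule linearI) (simp_all add: T'_def C_def sharp_simps S_simps blinfun.add_left blinfun.scaleR_left form_simps)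
  moreover have "T' \<alpha> \<beta> \<gamma> = T' \<beta> \<alpha> \<gamma>" "T' \<alpha> \<beta> \<gamma> = T' \<alpha> \<gamma> \<beta>" for \<alpha> \<beta> \<gamma>
    unfolding T'_def by (rule C)+
  ultimately have "T' \<in> S3 UNIV"
    by (rule S3_UNIV_I)
  moreover have low: "\<omega> (S X Y) Z = lower \<omega> T' X Y Z" for X Y Z
    by (simp add: lower_flat T'_def C_def sharp_flat)
  ultimately have "T = T'"
    unfolding T_def by (rule tensor_of_eqI)
  then show "T \<in> S3 UNIV" and "operator_of \<omega> T = (\<lambda>x. blinfun_apply (S x))"
    using \<open>T' \<in> S3 UNIV\<close> operator_of_eqI[OF low] by simp_all
qed

text \<open>Between isotropic subspaces every linear map is compatible with the form, both sides
  being zero, so \<open>extend_isometry\<close> asks only for injectivity.\<close>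

lemma Sp_extension:
  assumes "subspace U" and "linear f" and "inj_on f U" and "isotropic \<omega> U" and "isotropic \<omega> (f ` U)"
  obtains g where "g \<in> Sp \<omega>" and "\<And>u. u \<in> U \<Longrightarrow> blinfun_apply g u = f u"
proof -
  have "\<omega> (f x) (f y) = \<omega> x y" if "x \<in> U" "y \<in> U" for x y
    using assms(4,5) that by (simp add: isotropic_def)
  then obtain h where h: "linear h" "\<forall>x\<in>U. h x = f x" "\<forall>x y. \<omega> (h x) (h y) = \<omega> x y"
    using extend_isometry[OF assms(1-3)] by blast
  then have "blinfun_apply (Blinfun h) = h"
    by (simp add: bounded_linear bounded_linear_Blinfun_apply)
  with h that[of "Blinfun h"] show thesis
    by (simp add: Sp_def)
qed

end

section \<open>The correspondence\<close>

locale isotropic_subspace = symplectic_space \<omega> E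
  for \<omega> :: "'a::real_inner \<Rightarrow> 'a \<Rightarrow> real" and E +
  fixes W :: "'a set"
  assumes subspace_W: "subspace W" and isotropic_W: "isotropic \<omega> W"
begin

text \<open>The number \<open>2n - k\<close> of the theorem, namely the dimension of the complement
  of \<open>W\<close>.\<close>

definition codim :: nat where
  "codim = dim (UNIV :: 'a set) - dim W"

definition tensor :: "'a affine_map set \<Rightarrow> 'a cubic" where
  "tensor H = tensor_of \<omega> (S_of \<omega> H)"

lemma tensor_graph:
  assumes "nilpotent_symbol \<omega> S"
  shows "tensor (graph_group UNIV S) = tensor_of \<omega> (\<lambda>x. blinfun_apply (S x))"
proof -
  interpret nilpotent \<omega> E S by unfold_locales (rule assms)
  show ?thesis
    by (simp add: tensor_def S_of_graph)
qed

lemma tensor_props: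
  assumes "H \<in> Abelian_groups \<omega> codim"
  shows tensor_S3: "tensor H \<in> S3 UNIV"
    and isotropic_tensor: "isotropic \<omega> (support (operator_of \<omega> (tensor H)))"
    and dim_support_tensor: "dim (support (operator_of \<omega> (tensor H))) = dim W"
proof -
  obtain S where S: "nilpotent_symbol \<omega> S" "H = graph_group UNIV S"
    using Abelian_group_is_graph[OF assms] .
  interpret nilpotent \<omega> E S by unfold_locales (rule S)
  show "tensor H \<in> S3 UNIV" "isotropic \<omega> (support (operator_of \<omega> (tensor H)))"
    using S tensor_of_nilpotent_symbol[OF S(1)] isotropic_support by (simp_all add: tensor_graph)
  have "dim W \<le> dim (UNIV :: 'a set)"
    by (rule fd.dim_subset) simp
  then show "dim (support (operator_of \<omega> (tensor H))) = dim W"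
    using S assms tensor_of_nilpotent_symbol[OF S(1)] dim_kernel
    by (simp add: tensor_graph Abelian_groups_graph codim_def)
qed

lemma conj_rel_iff:
  assumes "H \<in> Abelian_groups \<omega> codim" and "H' \<in> Abelian_groups \<omega> codim"
  shows "(H, H') \<in> conj_rel \<omega> codim \<longleftrightarrow> (\<exists>g\<in>Sp \<omega>. tensor H' = act g (tensor H))"
proof -
  obtain S S' where S: "nilpotent_symbol \<omega> S" "H = graph_group UNIV S"
    and S': "nilpotent_symbol \<omega> S'" "H' = graph_group UNIV S'"
    using Abelian_group_is_graph assms by metis
  have "(H, H') \<in> conj_rel \<omega> codim \<longleftrightarrow> (\<exists>A\<in>Sp \<omega>. \<forall>x y. S' (A x) (A y) = A (S x y))"
    using assms conj_graph[OF S(1) S'(1)] S(2) S'(2) by (simp add: conj_rel_def)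
  also have "\<dots> \<longleftrightarrow> (\<exists>g\<in>Sp \<omega>. tensor H' = act g (tensor H))"
  proof (rule bex_cong[OF refl])
    have op: "operator_of \<omega> (tensor H) = (\<lambda>x. blinfun_apply (S x))"
      "operator_of \<omega> (tensor H') = (\<lambda>x. blinfun_apply (S' x))"
      unfolding S(2) S'(2) tensor_graph[OF S(1)] tensor_graph[OF S'(1)]
      by (rule tensor_of_nilpotent_symbol(2)[OF S(1)] tensor_of_nilpotent_symbol(2)[OF S'(1)])+
    show "(\<forall>x y. S' (g x) (g y) = g (S x y)) \<longleftrightarrow> tensor H' = act g (tensor H)" if "g \<in> Sp \<omega>" for g
      using act_eq_iff[OF tensor_S3[OF assms(1)] tensor_S3[OF assms(2)] that] by (simp add: op)
  qed
  finally show ?thesis .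
qed

lemma equiv_conj_rel: "equiv (Abelian_groups \<omega> codim) (conj_rel \<omega> codim)"
proof (rule equivI)
  show "conj_rel \<omega> codim \<subseteq> Abelian_groups \<omega> codim \<times> Abelian_groups \<omega> codim"
    by (auto simp: conj_rel_def)
  show "refl_on (Abelian_groups \<omega> codim) (conj_rel \<omega> codim)"
    unfolding refl_on_def using conj_rel_iff id_Sp act_id[symmetric] by blast
  have sub: "H \<in> Abelian_groups \<omega> codim \<and> H' \<in> Abelian_groups \<omega> codim" if "(H, H') \<in> conj_rel \<omega> codim" for H H'
    using that by (simp add: conj_rel_def)
  show "sym (conj_rel \<omega> codim)"
  proof (rule symI)
    fix H H' assume *: "(H, H') \<in> conj_rel \<omega> codim"
    then obtain g where "g \<in> Sp \<omega>" "tensor H' = act g (tensor H)"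
      using conj_rel_iff sub by blast
    moreover obtain g' where "g' \<in> Sp \<omega>" "g' o\<^sub>L g = id_blinfun"
      using Sp_inverse \<open>g \<in> Sp \<omega>\<close> by metis
    ultimately show "(H', H) \<in> conj_rel \<omega> codim"
      using conj_rel_iff sub[OF *] by (metis act_act act_id)
  qed
  show "trans (conj_rel \<omega> codim)"
  proof (rule transI)
    fix H H' H'' assume *: "(H, H') \<in> conj_rel \<omega> codim" "(H', H'') \<in> conj_rel \<omega> codim"
    then show "(H, H'') \<in> conj_rel \<omega> codim"
      using conj_rel_iff sub[OF *(1)] sub[OF *(2)] by (metis act_act Sp_compose)
  qed
qed

lemma cubics_of_eq: "cubics_of \<omega> W H = {T \<in> S3_reg \<omega> W. \<exists>g\<in>Sp \<omega>. T = act g (tensor H)}"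
  by (simp add: cubics_of_def tensor_def)

lemma cubics_of_conj:
  assumes "(H, H') \<in> conj_rel \<omega> codim"
  shows "cubics_of \<omega> W H = cubics_of \<omega> W H'"
proof -
  have "cubics_of \<omega> W H' \<subseteq> cubics_of \<omega> W H" if HH': "(H, H') \<in> conj_rel \<omega> codim" for H H'
  proof -
    obtain g where g: "g \<in> Sp \<omega>" "tensor H' = act g (tensor H)"
      using HH' conj_rel_iff[of H H'] unfolding conj_rel_def by blast
    show ?thesis
      unfolding cubics_of_eq g(2) act_act using Sp_compose[OF _ g(1)] by blast
  qed
  then show ?thesis
    using assms equiv_conj_rel by (meson equivE symD subset_antisym)
qed

text \<open>The support of the tensor and \<open>W\<close> are isotropic of equal dimension, so a
  symplectic map carries one onto the other and moves the tensor into \<open>S3_reg\<close>.\<close>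

lemma cubics_of_nonempty:
  assumes "H \<in> Abelian_groups \<omega> codim"
  obtains T where "T \<in> cubics_of \<omega> W H"
proof -
  define U where "U = support (operator_of \<omega> (tensor H))"
  have U: "subspace U" "isotropic \<omega> U" "dim U = dim W"
    using tensor_props[OF assms] by (simp_all add: U_def) (simp add: support_def)
  obtain f where f: "linear f" "f ` U = W" "inj_on f U"
    using fd.subspace_isomorphism[OF U(1) subspace_W U(3)] by blast
  obtain g where g: "g \<in> Sp \<omega>" "\<And>u. u \<in> U \<Longrightarrow> blinfun_apply g u = f u"
    using Sp_extension[OF U(1) f(1,3) U(2)] f(2) isotropic_W by metis
  have "support (operator_of \<omega> (act g (tensor H))) = W"
    using support_act[OF tensor_S3[OF assms] g(1)] g(2) f(2) by (simp add: U_def)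
  then have "act g (tensor H) \<in> cubics_of \<omega> W H"
    using g(1) S3_I act_S3 tensor_S3[OF assms] by (auto simp: cubics_of_eq S3_reg_def)
  with that show thesis .
qed

text \<open>A symplectic map between two tensors with support \<open>W\<close> preserves
  \<open>W\<close> and so restricts to GL(W). Conversely, an element of GL(W) agrees on
  \<open>W\<close> with a symplectic map, and the action on \<open>S3 W\<close> depends only on the
  restriction to \<open>W\<close>.\<close>

lemma cubics_of_eq_GL_class:
  assumes "T \<in> cubics_of \<omega> W H"
  shows "cubics_of \<omega> W H = GL_rel \<omega> W `` {T}"
proof -
  obtain h where T: "T \<in> S3_reg \<omega> W" and h: "h \<in> Sp \<omega>" "T = act h (tensor H)"
    using assms by (auto simp: cubics_of_eq)
  have TU: "T \<in> S3 UNIV" "T \<in> S3 W" "support (operator_of \<omega> T) = W"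
    using T S3_subset by (auto simp: S3_reg_def)
  show ?thesis
  proof (intro equalityI subsetI)
    fix T' assume "T' \<in> cubics_of \<omega> W H"
    then obtain h' where T': "T' \<in> S3_reg \<omega> W" and h': "h' \<in> Sp \<omega>" "T' = act h' (tensor H)"
      by (auto simp: cubics_of_eq)
    obtain i where i: "i \<in> Sp \<omega>" "i o\<^sub>L h = id_blinfun"
      using Sp_inverse[OF h(1)] by metis
    \<comment> \<open>From \<open>T\<close> back to the tensor of \<open>H\<close>, then on to
      \<open>T'\<close>.\<close>
    define g where "g = h' o\<^sub>L i"
    have g: "g \<in> Sp \<omega>"
      by (simp add: g_def Sp_compose h' i)
    have T'g: "T' = act g T"
      unfolding g_def h' h act_act[symmetric] by (simp add: act_act i act_id)
    then have "g ` W = W"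
      using support_act[OF TU(1) g] TU(3) T' by (simp add: S3_reg_def)
    moreover have "inj g"
      using Sp_inverse[OF g] by (metis blinfun_apply_blinfun_compose id_blinfun.rep_eq id_apply inj_on_inverseI)
    ultimately have "bij_betw g W W"
      unfolding bij_betw_def using inj_on_subset[OF _ subset_UNIV] by blast
    with T T' T'g show "T' \<in> GL_rel \<omega> W `` {T}"
      by (auto simp: GL_rel_def)
  next
    fix T' assume "T' \<in> GL_rel \<omega> W `` {T}"
    then obtain g where T': "T' \<in> S3_reg \<omega> W" and g: "bij_betw (blinfun_apply g) W W" "T' = act g T"
      by (auto simp: GL_rel_def)
    obtain g' where g': "g' \<in> Sp \<omega>" "\<And>w. w \<in> W \<Longrightarrow> blinfun_apply g' w = g w"
      using Sp_extension[OF subspace_W, of "blinfun_apply g"] g(1) isotropic_W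
      by (metis bij_betw_def blinfun.bounded_linear_right bounded_linear.linear)
    have "act g' T = act g T"
      using g' g(1) TU(2) by (intro act_cong_on) (auto simp: bij_betw_def)
    then have "T' = act (g' o\<^sub>L h) (tensor H)"
      by (simp add: g(2) h(2) act_act)
    with T' show "T' \<in> cubics_of \<omega> W H"
      using Sp_compose[OF g'(1) h(1)] by (auto simp: cubics_of_eq)
  qed
qed

lemma cubics_of_surj:
  assumes "T \<in> S3_reg \<omega> W"
  obtains H where "H \<in> Abelian_groups \<omega> codim" and "T \<in> cubics_of \<omega> W H"
proof -
  have T: "T \<in> S3 UNIV" "support (operator_of \<omega> T) = W"
    using assms S3_subset by (auto simp: S3_reg_def)
  obtain S where S: "nilpotent_symbol \<omega> S" "(\<lambda>x. blinfun_apply (S x)) = operator_of \<omega> T"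
    using nilpotent_symbol_operator_of[OF T(1)] T(2) isotropic_W by metis
  interpret nilpotent \<omega> E S by unfold_locales (rule S)
  have "graph_group UNIV S \<in> Abelian_groups \<omega> codim"
    unfolding Abelian_groups_graph codim_def using dim_kernel by (simp add: S(2) T(2) flip: dim_kernel)
  moreover have "tensor (graph_group UNIV S) = T"
    using S tensor_of_operator_of[OF T(1)] by (simp add: tensor_graph)
  then have "T \<in> cubics_of \<omega> W (graph_group UNIV S)"
    using assms id_Sp act_id[of T, symmetric] unfolding cubics_of_eq by auto
  ultimately show thesis by (rule that)
qed

lemma conj_of_common_cubic:
  assumes "H \<in> Abelian_groups \<omega> codim" and "H' \<in> Abelian_groups \<omega> codim"
    and "T \<in> cubics_of \<omega> W H" and "T \<in> cubics_of \<omega> W H'"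
  shows "(H, H') \<in> conj_rel \<omega> codim"
proof -
  obtain g g' where g: "g \<in> Sp \<omega>" "T = act g (tensor H)" and g': "g' \<in> Sp \<omega>" "T = act g' (tensor H')"
    using assms(3,4) by (auto simp: cubics_of_eq)
  obtain i where i: "i \<in> Sp \<omega>" "i o\<^sub>L g' = id_blinfun"
    using Sp_inverse[OF g'(1)] by metis
  have "tensor H' = act (i o\<^sub>L g) (tensor H)"
    by (metis act_act act_id g(2) g'(2) i(2))
  then show ?thesis
    using conj_rel_iff[OF assms(1,2)] Sp_compose[OF i(1) g(1)] by blast
qed

text \<open>Injectivity combines \<open>cubics_of_nonempty\<close> with
  \<open>conj_of_common_cubic\<close>: groups with equal sets of cubics share a cubic and are
  therefore conjugate.\<close>

lemma cubics_of_bij: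
  "bij_betw (\<lambda>C. \<Union>(cubics_of \<omega> W ` C)) (Abelian_groups \<omega> codim // conj_rel \<omega> codim) (S3_reg \<omega> W // GL_rel \<omega> W)"
proof -
  let ?A = "Abelian_groups \<omega> codim" and ?R = "conj_rel \<omega> codim"
  \<comment> \<open>All members of the union coincide, by invariance under conjugation.\<close>
  have cls: "\<Union>(cubics_of \<omega> W ` (?R `` {H})) = cubics_of \<omega> W H" if "H \<in> ?A" for H
    using that cubics_of_conj equiv_class_self[OF equiv_conj_rel] by blast
  have mem: "cubics_of \<omega> W H \<subseteq> S3_reg \<omega> W" for H
    by (auto simp: cubics_of_eq)
  show ?thesis
    unfolding bij_betw_def
  proof
    show "inj_on (\<lambda>C. \<Union>(cubics_of \<omega> W ` C)) (?A // ?R)"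
    proof (rule inj_onI)
      fix C C' assume "C \<in> ?A // ?R" "C' \<in> ?A // ?R" and eq: "\<Union>(cubics_of \<omega> W ` C) = \<Union>(cubics_of \<omega> W ` C')"
      then obtain H H' where H: "H \<in> ?A" "C = ?R `` {H}" "H' \<in> ?A" "C' = ?R `` {H'}"
        by (auto elim!: quotientE)
      then have "cubics_of \<omega> W H = cubics_of \<omega> W H'"
        using eq cls by simp
      then have "(H, H') \<in> ?R"
        using cubics_of_nonempty[OF H(1)] conj_of_common_cubic H by metis
      then show "C = C'"
        using H equiv_class_eq[OF equiv_conj_rel] by simp
    qed
    show "(\<lambda>C. \<Union>(cubics_of \<omega> W ` C)) ` (?A // ?R) = S3_reg \<omega> W // GL_rel \<omega> W"
    proof (intro equalityI subsetI)
      fix D assume "D \<in> (\<lambda>C. \<Union>(cubics_of \<omega> W ` C)) ` (?A // ?R)"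
      then obtain H where H: "H \<in> ?A" "D = cubics_of \<omega> W H"
        using cls by (auto elim!: quotientE)
      then obtain T where "T \<in> cubics_of \<omega> W H"
        using cubics_of_nonempty[OF H(1)] by metis
      then show "D \<in> S3_reg \<omega> W // GL_rel \<omega> W"
        using cubics_of_eq_GL_class[of T H] H(2) mem quotientI[of T "S3_reg \<omega> W" "GL_rel \<omega> W"] by auto
    next
      fix D assume "D \<in> S3_reg \<omega> W // GL_rel \<omega> W"
      then obtain T where T: "T \<in> S3_reg \<omega> W" "D = GL_rel \<omega> W `` {T}"
        by (auto elim!: quotientE)
      then obtain H where H: "H \<in> ?A" "T \<in> cubics_of \<omega> W H"
        using cubics_of_surj[OF T(1)] by metis
      then have "D = \<Union>(cubics_of \<omega> W ` (?R `` {H}))"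
        using cls cubics_of_eq_GL_class T(2) by simp
      then show "D \<in> (\<lambda>C. \<Union>(cubics_of \<omega> W ` C)) ` (?A // ?R)"
        using quotientI[OF H(1)] by blast
    qed
  qed
qed

end

theorem corollary1:
  fixes \<omega> :: "'a::real_inner \<Rightarrow> 'a \<Rightarrow> real" and W :: "'a set" and n k :: nat
  assumes "\<exists>B :: 'a set. finite B \<and> span B = UNIV"
    and "dim (UNIV :: 'a set) = 2 * n"
    and "symplectic_form \<omega>"
    and "k \<le> n"
    and "subspace W" and "dim W = k" and "isotropic \<omega> W"
  shows "cubics_of \<omega> W respects conj_rel \<omega> (2 * n - k) \<and>
    bij_betw (\<lambda>C. \<Union>(cubics_of \<omega> W ` C))
      (Abelian_groups \<omega> (2 * n - k) // conj_rel \<omega> (2 * n - k))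
      (S3_reg \<omega> W // GL_rel \<omega> W)"
proof -
  obtain B :: "'a set" where B: "finite B" "span B = UNIV"
    using assms(1) by blast
  \<comment> \<open>The hypothesis supplies a finite spanning set, the locale asks for a
    basis.\<close>
  obtain E where E: "E \<subseteq> B" "independent E" "B \<subseteq> span E"
    using maximal_independent_subset[of B] by blast
  have "span E = UNIV"
    using B(2) span_mono[OF E(3)] by (simp add: span_span top.extremum_unique)
  then interpret isotropic_subspace \<omega> E W
    using B E assms by unfold_locales (auto intro: finite_subset)
  have "codim = 2 * n - k"
    using assms by (simp add: codim_def)
  then show ?thesis
    using cubics_of_bij cubics_of_conj by (auto intro!: congruentI)
qed

end
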